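(* Let $K$ and $L$ be two $C^1$ curves (one-dimensional boundaryless $C^1$-submanifolds) in a two-dimensional smooth manifold $M$, and let $p\in K\cap L$. Then $K$ and $L$ are $C^0$ transverse at $p$ in the sense of Sakai if and only if $K$ and $L$ are $C^0$ transverse at $p$ as subsets of $M$ (in the sense of essential intersections); both notions are defined in the context.
   Context: Manifolds are Hausdorff and paracompact; $M$ carries a fixed (Riemannian) metric $\mathrm{dist}$ compatible with its topology. Sakai's definition. For $a>0$ let $D_a$ be the open disk of radius $a$ in $M$ centered at $p$. If $a$ is small enough, then $K'$, the connected component of $K\cap D_a$ containing $p$, separates $D_a$ into two open components $D_a^+$ and $D_a^-$ (each homeomorphic to an open disk). The curves $K$ and $L$ are $C^0$ transverse at $p$ in the sense of Sakai if for any sufficiently small $a>0$ the connected component $L'$ of $L\cap D_a$ containing $p$ intersects both $D_a^+$ and $D_a^-$. Definition by essential intersections. For continuous mappings $f_1,f_2\colon X\to M$ of a topological space $X$, put $|f_1,f_2|_{C^0}=\sup_{x\in X}\mathrm{dist}(f_1(x),f_2(x))$. For topological spaces $X,Y$, continuous mappings $h_1\colon X\to M$, $h_2\colon Y\to M$, arbitrary subsets $U_X\subset X$, $U_Y\subset Y$, and $\delta>0$, the intersection $h_1(U_X)\cap h_2(U_Y)$ is called $\delta$-essential if $\widetilde{h_1}(U_X)\cap\widetilde{h_2}(U_Y)\ne\varnothing$ for any continuous mappings $\widetilde{h_1}\colon X\to M$ and $\widetilde{h_2}\colon Y\to M$ with $|h_1,\widetilde{h_1}|_{C^0}\le\delta$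 and $|h_2,\widetilde{h_2}|_{C^0}\le\delta$. If $h_1(x)=h_2(y)$, then $h_1$ and $h_2$ are called $C^0$ transverse at the pair $(x,y)$ if for any open sets $U(x)\subset X$ and $U(y)\subset Y$ with $x\in U(x)$ and $y\in U(y)$ there exists $\delta>0$ such that $h_1(U(x))\cap h_2(U(y))$ is $\delta$-essential. Subsets $A,B\subset M$ are called $C^0$ transverse at a point $p\in A\cap B$ if the inclusion embeddings $i_A\colon A\to M$ and $i_B\colon B\to M$ are $C^0$ transverse at the pair $(p,p)$. *)

theory Defs
  imports "HOL-Analysis.Analysis"
begin

section \<open>Maps of class \<open>C\<^sup>k\<close> on open subsets of a Euclidean space\<close>

text \<open>For open \<open>S\<close> in a finite-dimensional space, continuity of all iterated
  directional derivatives is equivalent to continuity of the iterated derivatives in operator norm.\<close>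

primrec Ck_on :: "nat \<Rightarrow> ('n::euclidean_space \<Rightarrow> 'b::real_normed_vector) \<Rightarrow> 'n set \<Rightarrow> bool" where
  "Ck_on 0 = (\<lambda>f S. continuous_on S f)"
| "Ck_on (Suc k) = (\<lambda>f S. (\<forall>x\<in>S. f differentiable (at x)) \<and>
      (\<forall>v. Ck_on k (\<lambda>x. frechet_derivative f (at x) v) S))"

section \<open>Smooth surfaces\<close>

text \<open>The surface \<open>M\<close> is the whole type \<open>'a\<close>. Its topology is that of a metric, hence it is
  Hausdorff and paracompact. It is not assumed to be connected or second countable.
  A chart is a pair of its domain and its coordinate map; the values of the coordinate map
  outside the domain are irrelevant.\<close>

type_synonym 'a chart = "'a set \<times> ('a \<Rightarrow> real^2)"

abbreviation dom_of :: "'a chart \<Rightarrow> 'a set" where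
  "dom_of c \<equiv> fst c"

abbreviation coord :: "'a chart \<Rightarrow> 'a \<Rightarrow> real^2" where
  "coord c \<equiv> snd c"

definition chart_inv :: "'a chart \<Rightarrow> real^2 \<Rightarrow> 'a" where
  "chart_inv c = inv_into (dom_of c) (coord c)"

definition is_chart :: "'a::topological_space chart \<Rightarrow> bool" where
  "is_chart c \<longleftrightarrow> open (dom_of c) \<and> open (coord c ` dom_of c) \<and>
     homeomorphism (dom_of c) (coord c ` dom_of c) (coord c) (chart_inv c)"

definition transition :: "'a chart \<Rightarrow> 'a chart \<Rightarrow> real^2 \<Rightarrow> real^2" where
  "transition c d = coord d \<circ> chart_inv c"

definition Ck_compatible :: "nat \<Rightarrow> 'a chart \<Rightarrow> 'a chart \<Rightarrow> bool" where
  "Ck_compatible k c d \<longleftrightarrow>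
     Ck_on k (transition c d) (coord c ` (dom_of c \<inter> dom_of d)) \<and>
     Ck_on k (transition d c) (coord d ` (dom_of c \<inter> dom_of d))"

definition smooth_atlas :: "'a::topological_space chart set \<Rightarrow> bool" where
  "smooth_atlas A \<longleftrightarrow> (\<forall>c\<in>A. is_chart c) \<and> (\<Union>c\<in>A. dom_of c) = UNIV \<and>
     (\<forall>c\<in>A. \<forall>d\<in>A. \<forall>k. Ck_compatible k c d)"

text \<open>An (embedded) one-dimensional \<open>C\<^sup>1\<close> submanifold without boundary: near each of its points
  it is a coordinate axis in some chart of the \<open>C\<^sup>1\<close> structure determined by the atlas.
  It need not be closed or connected.\<close>

definition C1_curve :: "'a::topological_space chart set \<Rightarrow> 'a set \<Rightarrow> bool" where
  "C1_curve A K \<longleftrightarrow> (\<forall>q\<in>K. \<exists>c. is_chart c \<and> (\<forall>d\<in>A. Ck_compatible 1 c d) \<and> q \<in> dom_of c \<and>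
     coord c ` (dom_of c \<inter> K) = {y \<in> coord c ` dom_of c. y $ 2 = 0})"

section \<open>Riemannian metrics and their distance\<close>

text \<open>A Riemannian metric is given by its expressions in the charts: \<open>g c q v w\<close> is the inner
  product at \<open>q\<close> of the tangent vectors with coordinates \<open>v\<close> and \<open>w\<close> in the chart \<open>c\<close>.\<close>

type_synonym 'a metric_tensor = "'a chart \<Rightarrow> 'a \<Rightarrow> real^2 \<Rightarrow> real^2 \<Rightarrow> real"

definition riemannian_metric :: "'a::topological_space chart set \<Rightarrow> 'a metric_tensor \<Rightarrow> bool" where
  "riemannian_metric A g \<longleftrightarrow>
     (\<forall>c\<in>A. \<forall>q\<in>dom_of c. bilinear (g c q) \<and> (\<forall>v w. g c q v w = g c q w v) \<and>
        (\<forall>v. v \<noteq> 0 \<longrightarrow> g c q v v > 0)) \<and>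
     (\<forall>c\<in>A. \<forall>v w k. Ck_on k (\<lambda>y. g c (chart_inv c y) v w) (coord c ` dom_of c)) \<and>
     (\<forall>c\<in>A. \<forall>d\<in>A. \<forall>q\<in>dom_of c \<inter> dom_of d. \<forall>v w.
        g c q v w = g d q (frechet_derivative (transition c d) (at (coord c q)) v)
                          (frechet_derivative (transition c d) (at (coord c q)) w))"

text \<open>\<open>C\<^sup>1\<close> paths on the closed unit interval, with one-sided derivatives at the end points.\<close>

definition C1_path :: "'a::topological_space chart set \<Rightarrow> (real \<Rightarrow> 'a) \<Rightarrow> bool" where
  "C1_path A \<gamma> \<longleftrightarrow> path \<gamma> \<and>
     (\<forall>c\<in>A. \<exists>D. continuous_on {t\<in>{0..1}. \<gamma> t \<in> dom_of c} D \<and>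
        (\<forall>t\<in>{0..1}. \<gamma> t \<in> dom_of c \<longrightarrow>
           ((coord c \<circ> \<gamma>) has_vector_derivative D t) (at t within {0..1})))"

text \<open>The choice of the chart does not matter, by the transformation law of the metric.\<close>

definition riemannian_speed ::
    "'a chart set \<Rightarrow> 'a metric_tensor \<Rightarrow> (real \<Rightarrow> 'a) \<Rightarrow> real \<Rightarrow> real" where
  "riemannian_speed A g \<gamma> t =
     (let c = (SOME c. c \<in> A \<and> \<gamma> t \<in> dom_of c);
          v = vector_derivative (coord c \<circ> \<gamma>) (at t within {0..1})
      in sqrt (g c (\<gamma> t) v v))"

definition riemannian_length ::
    "'a chart set \<Rightarrow> 'a metric_tensor \<Rightarrow> (real \<Rightarrow> 'a) \<Rightarrow> real" where
  "riemannian_length A g \<gamma> = integral {0..1} (riemannian_speed A g \<gamma>)"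

definition C1_paths_between :: "'a::topological_space chart set \<Rightarrow> 'a \<Rightarrow> 'a \<Rightarrow> (real \<Rightarrow> 'a) set" where
  "C1_paths_between A x y = {\<gamma>. C1_path A \<gamma> \<and> pathstart \<gamma> = x \<and> pathfinish \<gamma> = y}"

text \<open>The distance of the type is the one induced by \<open>g\<close> on each connected component of \<open>M\<close>.
  The distance between points of different components, where the infimum is over the empty set,
  is not prescribed; it only has to be part of a metric on \<open>M\<close> inducing the topology of \<open>M\<close>.\<close>

definition riemannian_distance ::
    "'a::metric_space chart set \<Rightarrow> 'a metric_tensor \<Rightarrow> bool" where
  "riemannian_distance A g \<longleftrightarrow>
     (\<forall>x y. C1_paths_between A x y \<noteq> {} \<longrightarrow>
        dist x y = (INF \<gamma>\<in>C1_paths_between A x y. riemannian_length A g \<gamma>))"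

section \<open>Transversality in the sense of Sakai\<close>

text \<open>\<open>P\<close> and \<open>N\<close> are the two sides of the component of \<open>K \<inter> ball p a\<close> containing \<open>p\<close>; the
  condition is symmetric in them, so it does not matter which one is called positive.\<close>

definition sakai_transverse :: "'a::metric_space set \<Rightarrow> 'a set \<Rightarrow> 'a \<Rightarrow> bool" where
  "sakai_transverse K L p \<longleftrightarrow>
     (\<exists>a0>0. \<forall>a. 0 < a \<and> a < a0 \<longrightarrow>
        (let K' = connected_component_set (K \<inter> ball p a) p;
             L' = connected_component_set (L \<inter> ball p a) p
         in \<exists>P N. P \<noteq> N \<and> components (ball p a - K') = {P, N} \<and> open P \<and> open N \<and>
                  L' \<inter> P \<noteq> {} \<and> L' \<inter> N \<noteq> {}))"

section \<open>Transversality by essential intersections\<close>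

definition C0_dist :: "'x topology \<Rightarrow> ('x \<Rightarrow> 'a::metric_space) \<Rightarrow> ('x \<Rightarrow> 'a) \<Rightarrow> ennreal" where
  "C0_dist X f1 f2 = (SUP x\<in>topspace X. ennreal (dist (f1 x) (f2 x)))"

definition essential_intersection ::
    "'x topology \<Rightarrow> 'y topology \<Rightarrow> ('x \<Rightarrow> 'a::metric_space) \<Rightarrow> ('y \<Rightarrow> 'a) \<Rightarrow>
     'x set \<Rightarrow> 'y set \<Rightarrow> real \<Rightarrow> bool" where
  "essential_intersection X Y h1 h2 UX UY \<delta> \<longleftrightarrow>
     (\<forall>k1 k2. continuous_map X euclidean k1 \<and> continuous_map Y euclidean k2 \<and>
        C0_dist X h1 k1 \<le> ennreal \<delta> \<and> C0_dist Y h2 k2 \<le> ennreal \<delta> \<longrightarrow>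
        k1 ` UX \<inter> k2 ` UY \<noteq> {})"

definition C0_transverse_at_pair ::
    "'x topology \<Rightarrow> 'y topology \<Rightarrow> ('x \<Rightarrow> 'a::metric_space) \<Rightarrow> ('y \<Rightarrow> 'a) \<Rightarrow> 'x \<Rightarrow> 'y \<Rightarrow> bool" where
  "C0_transverse_at_pair X Y h1 h2 x y \<longleftrightarrow>
     x \<in> topspace X \<and> y \<in> topspace Y \<and> h1 x = h2 y \<and>
     (\<forall>U V. openin X U \<and> openin Y V \<and> x \<in> U \<and> y \<in> V \<longrightarrow>
        (\<exists>\<delta>>0. essential_intersection X Y h1 h2 U V \<delta>))"

definition C0_transverse_subsets :: "'a::metric_space set \<Rightarrow> 'a set \<Rightarrow> 'a \<Rightarrow> bool" where
  "C0_transverse_subsets A B p \<longleftrightarrow>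
     C0_transverse_at_pair (top_of_set A) (top_of_set B) (\<lambda>x. x) (\<lambda>x. x) p p"

end

theory Submission
  imports Defs
begin

text \<open>Both notions of transversality are equivalent to one elementary condition, called
  \<open>crosses\<close> below: if \<open>K\<close> is straightened to the horizontal axis by a chart, then every
  neighbourhood of \<open>p\<close> contains points of \<open>L\<close> strictly above and points of \<open>L\<close> strictly below
  the axis.

  Sakai's condition concerns the two sides of the component \<open>K'\<close> of \<open>K\<close> in a small metric ball.
  The two half-neighbourhoods of the points of \<open>K'\<close> belong to at most two components of the
  complement of \<open>K'\<close>, because \<open>K'\<close> is connected, and every component touches \<open>K'\<close>. The
  upper and the lower component differ because the ball is contractible
  (\<open>axis_separation\<close>): in coordinates there is a continuous \<open>f\<close> from the ball to the nonzero
  complex numbers that takes positive real values exactly on \<open>K'\<close> and whose imaginary part is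
  the height; it has a continuous square root \<open>h\<close>, and \<open>Im h\<close> has no zero off \<open>K'\<close> but
  opposite signs directly above and below a point of \<open>K'\<close>.
  If \<open>L\<close> stays on one side of \<open>K\<close> near \<open>p\<close>, then the component of \<open>L\<close> in a small ball cannot
  meet both sides: it would have to pass from one to the other at a point of \<open>K'\<close>, where it only
  sees one of them (\<open>one_sided_arc\<close>).

  Contractibility of small balls is where the Riemannian metric enters
  (\<open>small_ball_starlike\<close>): in a smooth chart centred at \<open>p\<close>, contract a path from \<open>p\<close>
  to \<open>x\<close> towards \<open>p\<close> by a factor \<open>s \<le> 1\<close>. The factor \<open>s\<close> gained in the velocity outweighs the
  change of the metric coefficients, which are Lipschitz near \<open>p\<close>, as long as the path is close to \<open>p\<close>.
  So no length increases and the ball is star-shaped in this chart.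

  For essential intersections, if \<open>L\<close> stays on one side of \<open>K\<close> near \<open>p\<close>, then an arbitrarily
  small push away from the axis makes the images of small neighbourhoods disjoint
  (\<open>not_transverse_if_one_sided\<close>). If \<open>L\<close> crosses \<open>K\<close>, then a segment of \<open>K\<close> and an arc of
  \<open>L\<close> from below to above the axis still cross a rectangle in the two directions after a small
  perturbation, and such paths meet (\<open>transverse_if_crosses\<close>).\<close>

section \<open>Charts\<close>

lemma chart_homeomorphism:
  "is_chart c \<Longrightarrow> homeomorphism (dom_of c) (coord c ` dom_of c) (coord c) (chart_inv c)"
  by (simp add: is_chart_def)

lemma chart_inv_coord: "is_chart c \<Longrightarrow> q \<in> dom_of c \<Longrightarrow> chart_inv c (coord c q) = q"
  by (simp add: is_chart_def homeomorphism_def)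

lemma coord_chart_inv:
  assumes "is_chart c" "y \<in> coord c ` dom_of c"
  shows "coord c (chart_inv c y) = y" "chart_inv c y \<in> dom_of c"
  using assms chart_inv_coord[OF assms(1)] by auto

lemma continuous_on_coord: "is_chart c \<Longrightarrow> continuous_on (dom_of c) (coord c)"
  and continuous_on_chart_inv: "is_chart c \<Longrightarrow> continuous_on (coord c ` dom_of c) (chart_inv c)"
  by (auto simp: is_chart_def homeomorphism_def)

lemma open_coord_image:
  assumes c: "is_chart c" and U: "open U"
  shows "open (coord c ` (dom_of c \<inter> U))"
proof -
  have "coord c ` (dom_of c \<inter> U) = coord c ` dom_of c \<inter> chart_inv c -` U"
    using chart_inv_coord[OF c] by (auto simp: image_iff)
  then show ?thesis
    using continuous_open_preimage[OF continuous_on_chart_inv[OF c] _ U] c by (simp add: is_chart_def)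
qed

lemma open_coord_vimage:
  assumes c: "is_chart c" and Y: "open Y"
  shows "open (dom_of c \<inter> coord c -` Y)"
  using continuous_open_preimage[OF continuous_on_coord[OF c] _ Y] c by (simp add: is_chart_def)

lemma open_chart_inv_image:
  assumes c: "is_chart c" and Y: "open Y" "Y \<subseteq> coord c ` dom_of c"
  shows "open (chart_inv c ` Y)"
proof -
  have "chart_inv c ` Y = dom_of c \<inter> coord c -` Y"
    using Y coord_chart_inv[OF c] chart_inv_coord[OF c] by (force simp: image_iff)
  then show ?thesis using open_coord_vimage[OF c Y(1)] by simp
qed

lemma Ck_on_1:
  "Ck_on (Suc 0) f S \<longleftrightarrow> (\<forall>x\<in>S. f differentiable (at x)) \<and>
     (\<forall>v. continuous_on S (\<lambda>x. frechet_derivative f (at x) v))"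
  by simp

lemma atlas_chart: "smooth_atlas A \<Longrightarrow> c \<in> A \<Longrightarrow> is_chart c"
  and atlas_cover: "smooth_atlas A \<Longrightarrow> \<exists>c\<in>A. q \<in> dom_of c"
  by (auto simp: smooth_atlas_def)

lemma transition_coord:
  "is_chart c \<Longrightarrow> q \<in> dom_of c \<Longrightarrow> transition c d (coord c q) = coord d q"
  by (simp add: transition_def chart_inv_coord)

lemma transition_C1:
  assumes "smooth_atlas A" "c \<in> A" "d \<in> A"
  shows "\<forall>x\<in>coord c ` (dom_of c \<inter> dom_of d). 
           (transition c d has_derivative frechet_derivative (transition c d) (at x)) (at x)"
    and "continuous_on (coord c ` (dom_of c \<inter> dom_of d))
           (\<lambda>x. frechet_derivative (transition c d) (at x) v)"
proof -
  have "Ck_on (Suc 0) (transition c d) (coord c ` (dom_of c \<inter> dom_of d))"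
    using assms unfolding smooth_atlas_def Ck_compatible_def by blast
  then show "\<forall>x\<in>coord c ` (dom_of c \<inter> dom_of d). 
           (transition c d has_derivative frechet_derivative (transition c d) (at x)) (at x)"
    and "continuous_on (coord c ` (dom_of c \<inter> dom_of d))
           (\<lambda>x. frechet_derivative (transition c d) (at x) v)"
    unfolding Ck_on_1 using frechet_derivative_works by blast+
qed

lemma real2_expand: "(v::real^2) = v$1 *\<^sub>R axis 1 1 + v$2 *\<^sub>R axis 2 1"
  by (simp add: vec_eq_iff forall_2 axis_def)

lemma linear_real2_expand:
  fixes f :: "real^2 \<Rightarrow> 'b::real_vector"
  assumes "linear f"
  shows "f v = v$1 *\<^sub>R f (axis 1 1) + v$2 *\<^sub>R f (axis 2 1)"
  by (subst real2_expand) (simp add: assms linear_add linear_scale)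

lemma bilinear_real2_expand:
  fixes h :: "real^2 \<Rightarrow> real^2 \<Rightarrow> real"
  assumes h: "bilinear h"
  shows "h v v = v$1 * v$1 * h (axis 1 1) (axis 1 1) + v$1 * v$2 * h (axis 1 1) (axis 2 1)
     + v$2 * v$1 * h (axis 2 1) (axis 1 1) + v$2 * v$2 * h (axis 2 1) (axis 2 1)"
proof -
  have l: "linear (h x)" "linear (\<lambda>y. h y x)" for x
    using h by (auto simp: bilinear_def)
  have "h v v = v$1 *\<^sub>R h (axis 1 1) v + v$2 *\<^sub>R h (axis 2 1) v"
    by (rule linear_real2_expand[OF l(2)])
  also have "h (axis 1 1) v = v$1 *\<^sub>R h (axis 1 1) (axis 1 1) + v$2 *\<^sub>R h (axis 1 1) (axis 2 1)"
    by (rule linear_real2_expand[OF l(1)])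
  also have "h (axis 2 1) v = v$1 *\<^sub>R h (axis 2 1) (axis 1 1) + v$2 *\<^sub>R h (axis 2 1) (axis 2 1)"
    by (rule linear_real2_expand[OF l(1)])
  finally show ?thesis by (simp add: algebra_simps)
qed

section \<open>Velocity, speed and length of paths\<close>

definition velocity :: "'a chart \<Rightarrow> (real \<Rightarrow> 'a) \<Rightarrow> real \<Rightarrow> real^2" where
  "velocity c \<gamma> t = vector_derivative (coord c \<circ> \<gamma>) (at t within {0..1})"

lemma velocity_eqI:
  assumes "((coord c \<circ> \<gamma>) has_vector_derivative v) (at t within {0..1})" "t \<in> {0..1}"
  shows "velocity c \<gamma> t = v"
  unfolding velocity_def
  using assms by (intro vector_derivative_within) (simp_all add: trivial_limit_within islimpt_Icc)

lemma C1_path_velocity: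
  assumes "C1_path A \<gamma>" "c \<in> A"
  shows "continuous_on {t\<in>{0..1}. \<gamma> t \<in> dom_of c} (velocity c \<gamma>)"
    and "t \<in> {0..1} \<Longrightarrow> \<gamma> t \<in> dom_of c \<Longrightarrow>
      ((coord c \<circ> \<gamma>) has_vector_derivative velocity c \<gamma> t) (at t within {0..1})"
proof -
  obtain D where D: "continuous_on {t\<in>{0..1}. \<gamma> t \<in> dom_of c} D"
    "\<And>t. t\<in>{0..1} \<Longrightarrow> \<gamma> t \<in> dom_of c \<Longrightarrow>
       ((coord c \<circ> \<gamma>) has_vector_derivative D t) (at t within {0..1})"
    using assms unfolding C1_path_def by blast
  have eq: "velocity c \<gamma> t = D t" if "t \<in> {0..1}" "\<gamma> t \<in> dom_of c" for t
    using velocity_eqI D(2) that by blast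
  show "continuous_on {t\<in>{0..1}. \<gamma> t \<in> dom_of c} (velocity c \<gamma>)"
    by (rule continuous_on_eq[OF D(1)]) (use eq in auto)
  show "t \<in> {0..1} \<Longrightarrow> \<gamma> t \<in> dom_of c \<Longrightarrow>
      ((coord c \<circ> \<gamma>) has_vector_derivative velocity c \<gamma> t) (at t within {0..1})"
    using D(2) eq by simp
qed

text \<open>A path that is \<open>C\<^sup>1\<close> in one chart is \<open>C\<^sup>1\<close> in all charts of the atlas by the chain rule,
  the transition maps being \<open>C\<^sup>1\<close>. This turns coordinate constructions into competitors for the
  distance.\<close>

lemma C1_path_in_chart:
  assumes A: "smooth_atlas A" and c: "c \<in> A"
    and \<eta>: "\<And>t. t \<in> {0..1} \<Longrightarrow> \<eta> t \<in> coord c ` dom_of c"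
    and der: "\<And>t. t \<in> {0..1} \<Longrightarrow> (\<eta> has_vector_derivative \<eta>' t) (at t within {0..1})"
    and cont: "continuous_on {0..1} \<eta>'"
  shows "C1_path A (chart_inv c \<circ> \<eta>)"
    and "\<And>t. t \<in> {0..1} \<Longrightarrow> velocity c (chart_inv c \<circ> \<eta>) t = \<eta>' t"
proof -
  have ch: "is_chart c" using A c by (rule atlas_chart)
  have c\<eta>: "continuous_on {0..1} \<eta>"
    using der by (meson has_vector_derivative_continuous continuous_on_eq_continuous_within)
  have path: "path (chart_inv c \<circ> \<eta>)"
    unfolding path_def using \<eta>
    by (intro continuous_on_compose c\<eta> continuous_on_subset[OF continuous_on_chart_inv[OF ch]]) auto
  have "\<exists>D. continuous_on {t\<in>{0..1}. (chart_inv c \<circ> \<eta>) t \<in> dom_of d} D \<and>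
        (\<forall>t\<in>{0..1}. (chart_inv c \<circ> \<eta>) t \<in> dom_of d \<longrightarrow>
           ((coord d \<circ> (chart_inv c \<circ> \<eta>)) has_vector_derivative D t) (at t within {0..1}))"
    if d: "d \<in> A" for d
  proof -
    let ?F = "\<lambda>y. frechet_derivative (transition c d) (at y)"
    let ?S = "{t\<in>{0..1}. (chart_inv c \<circ> \<eta>) t \<in> dom_of d}"
    have in_overlap: "\<eta> t \<in> coord c ` (dom_of c \<inter> dom_of d)" if "t \<in> ?S" for t
    proof -
      have "\<eta> t \<in> coord c ` dom_of c" "chart_inv c (\<eta> t) \<in> dom_of d" using \<eta>[of t] that by auto
      with coord_chart_inv[OF ch this(1)] show ?thesis by (intro image_eqI[of _ _ "chart_inv c (\<eta> t)"]) auto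
    qed
    have F: "(transition c d has_derivative ?F (\<eta> t)) (at (\<eta> t))" if "t \<in> ?S" for t
      using transition_C1(1)[OF A c d] in_overlap[OF that] by blast
    have lin: "linear (?F (\<eta> t))" if "t \<in> ?S" for t
      using F[OF that] has_derivative_linear by blast
    have contF: "continuous_on ?S (\<lambda>t. ?F (\<eta> t) v)" for v
      by (rule continuous_on_compose2[OF transition_C1(2)[OF A c d]])
         (use in_overlap in \<open>auto intro: continuous_on_subset[OF c\<eta>]\<close>)
    have "continuous_on ?S
        (\<lambda>t. \<eta>' t $ 1 *\<^sub>R ?F (\<eta> t) (axis 1 1) + \<eta>' t $ 2 *\<^sub>R ?F (\<eta> t) (axis 2 1))"
      by (intro continuous_intros contF continuous_on_subset[OF cont]) auto
    then have "continuous_on ?S (\<lambda>t. ?F (\<eta> t) (\<eta>' t))"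
      by (rule continuous_on_eq) (rule linear_real2_expand[OF lin, symmetric])
    moreover have "((coord d \<circ> (chart_inv c \<circ> \<eta>)) has_vector_derivative ?F (\<eta> t) (\<eta>' t)) (at t within {0..1})"
      if "t \<in> ?S" for t
    proof -
      have "((transition c d \<circ> \<eta>) has_vector_derivative ?F (\<eta> t) (\<eta>' t)) (at t within {0..1})"
        by (rule vector_derivative_diff_chain_within)
           (use that der F in \<open>auto intro: has_derivative_at_withinI\<close>)
      then show ?thesis by (simp add: transition_def comp_assoc)
    qed
    ultimately show ?thesis by (intro exI[of _ "\<lambda>t. ?F (\<eta> t) (\<eta>' t)"]) auto
  qed
  with path show "C1_path A (chart_inv c \<circ> \<eta>)" unfolding C1_path_def by blast
  fix t :: real assume t: "t \<in> {0..1}"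
  show "velocity c (chart_inv c \<circ> \<eta>) t = \<eta>' t"
  proof (rule velocity_eqI[OF _ t])
    show "((coord c \<circ> (chart_inv c \<circ> \<eta>)) has_vector_derivative \<eta>' t) (at t within {0..1})"
      by (rule has_vector_derivative_transform[OF t _ der[OF t]])
         (simp add: coord_chart_inv(1)[OF ch \<eta>])
  qed
qed

lemma velocity_change:
  fixes A :: "'a::metric_space chart set"
  assumes A: "smooth_atlas A" and \<gamma>: "C1_path A \<gamma>" and cd: "c \<in> A" "d \<in> A"
    and t: "t \<in> {0..1}" and q: "\<gamma> t \<in> dom_of c" "\<gamma> t \<in> dom_of d"
  shows "velocity d \<gamma> t =
    frechet_derivative (transition c d) (at (coord c (\<gamma> t))) (velocity c \<gamma> t)"
proof -
  have ch: "is_chart c" "is_chart d" using A cd atlas_chart by blast+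
  have contg: "continuous_on {0..1} \<gamma>" using \<gamma> by (simp add: C1_path_def path_def)
  obtain e where e: "e > 0" "\<And>s. s \<in> {0..1} \<Longrightarrow> dist s t < e \<Longrightarrow> \<gamma> s \<in> dom_of c"
  proof -
    have "open (dom_of c)" using ch by (simp add: is_chart_def)
    then obtain r where "r > 0" "ball (\<gamma> t) r \<subseteq> dom_of c" using q open_contains_ball by blast
    then show ?thesis
      using contg t that unfolding continuous_on_iff by (metis mem_ball subsetD dist_commute)
  qed
  have "((transition c d \<circ> (coord c \<circ> \<gamma>)) has_vector_derivative
      frechet_derivative (transition c d) (at (coord c (\<gamma> t))) (velocity c \<gamma> t)) (at t within {0..1})"
    by (rule vector_derivative_diff_chain_within[OF C1_path_velocity(2)[OF \<gamma> cd(1) t q(1)]])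
       (use transition_C1(1)[OF A cd] q in \<open>auto intro: has_derivative_at_withinI\<close>)
  then have "((coord d \<circ> \<gamma>) has_vector_derivative
      frechet_derivative (transition c d) (at (coord c (\<gamma> t))) (velocity c \<gamma> t)) (at t within {0..1})"
    by (rule has_vector_derivative_transform_within[OF _ e(1) t])
       (simp add: transition_coord[OF ch(1) e(2)])
  then show ?thesis by (rule velocity_eqI[OF _ t])
qed

text \<open>The chart picked by the definition of the speed may be replaced by any other, because the metric
  and the velocities transform with the same derivative.\<close>

lemma riemannian_speed_chart:
  fixes A :: "'a::metric_space chart set"
  assumes A: "smooth_atlas A" and g: "riemannian_metric A g" and \<gamma>: "C1_path A \<gamma>"
    and c: "c \<in> A" and t: "t \<in> {0..1}" and q: "\<gamma> t \<in> dom_of c"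
  shows "riemannian_speed A g \<gamma> t = sqrt (g c (\<gamma> t) (velocity c \<gamma> t) (velocity c \<gamma> t))"
proof -
  define d where "d = (SOME c. c \<in> A \<and> \<gamma> t \<in> dom_of c)"
  have d: "d \<in> A \<and> \<gamma> t \<in> dom_of d" unfolding d_def by (rule someI) (use c q in blast)
  have "riemannian_speed A g \<gamma> t = sqrt (g d (\<gamma> t) (velocity d \<gamma> t) (velocity d \<gamma> t))"
    by (simp add: riemannian_speed_def d_def velocity_def Let_def)
  also have "g d (\<gamma> t) (velocity d \<gamma> t) (velocity d \<gamma> t) = g c (\<gamma> t) (velocity c \<gamma> t) (velocity c \<gamma> t)"
  proof -
    have "\<forall>q\<in>dom_of c \<inter> dom_of d. \<forall>v w.
        g c q v w = g d q (frechet_derivative (transition c d) (at (coord c q)) v)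
                          (frechet_derivative (transition c d) (at (coord c q)) w)"
      using g c d unfolding riemannian_metric_def by blast
    then show ?thesis using d q velocity_change[OF A \<gamma> c _ t q, of d] by simp
  qed
  finally show ?thesis .
qed

lemma metric_bilinear:
  assumes "riemannian_metric A g" "c \<in> A" "q \<in> dom_of c"
  shows "bilinear (g c q)" "g c q v v \<ge> 0" "v \<noteq> 0 \<Longrightarrow> g c q v v > 0"
proof -
  show b: "bilinear (g c q)" and "v \<noteq> 0 \<Longrightarrow> g c q v v > 0"
    using assms unfolding riemannian_metric_def by blast+
  then show "g c q v v \<ge> 0"
    using bilinear_lzero[OF b, of 0] by (cases "v = 0") auto
qed

lemma metric_coeff_C1:
  assumes "riemannian_metric A g" "c \<in> A"
  shows "Ck_on (Suc 0) (\<lambda>y. g c (chart_inv c y) v w) (coord c ` dom_of c)"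
  using assms unfolding riemannian_metric_def by blast

lemma metric_coeff_continuous:
  assumes "riemannian_metric A g" "c \<in> A"
  shows "continuous_on (coord c ` dom_of c) (\<lambda>y. g c (chart_inv c y) v w)"
proof -
  have "Ck_on 0 (\<lambda>y. g c (chart_inv c y) v w) (coord c ` dom_of c)"
    using assms unfolding riemannian_metric_def by blast
  then show ?thesis by simp
qed

lemma metric_continuous:
  assumes A: "smooth_atlas A" and g: "riemannian_metric A g" and c: "c \<in> A"
    and y: "continuous_on S y" "\<And>t. t \<in> S \<Longrightarrow> y t \<in> coord c ` dom_of c" and v: "continuous_on S v"
  shows "continuous_on S (\<lambda>t. g c (chart_inv c (y t)) (v t) (v t))"
proof -
  let ?G = "\<lambda>t i j. g c (chart_inv c (y t)) (axis i 1) (axis j 1)"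
  have G: "continuous_on S (\<lambda>t. ?G t i j)" for i j
    by (rule continuous_on_compose2[OF metric_coeff_continuous[OF g c] y(1)]) (use y(2) in auto)
  have "continuous_on S (\<lambda>t. v t $ 1 * v t $ 1 * ?G t 1 1 + v t $ 1 * v t $ 2 * ?G t 1 2
     + v t $ 2 * v t $ 1 * ?G t 2 1 + v t $ 2 * v t $ 2 * ?G t 2 2)"
    by (intro continuous_intros G v)
  then show ?thesis
  proof (rule continuous_on_eq)
    fix t assume "t \<in> S"
    then have "bilinear (g c (chart_inv c (y t)))"
      using metric_bilinear(1)[OF g c] coord_chart_inv(2)[OF atlas_chart[OF A c]] y(2) by blast
    then show "v t $ 1 * v t $ 1 * ?G t 1 1 + v t $ 1 * v t $ 2 * ?G t 1 2
     + v t $ 2 * v t $ 1 * ?G t 2 1 + v t $ 2 * v t $ 2 * ?G t 2 2 = g c (chart_inv c (y t)) (v t) (v t)"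
      by (rule bilinear_real2_expand[symmetric])
  qed
qed

lemma riemannian_speed_continuous:
  fixes A :: "'a::metric_space chart set"
  assumes A: "smooth_atlas A" and g: "riemannian_metric A g" and \<gamma>: "C1_path A \<gamma>"
  shows "continuous_on {0..1} (riemannian_speed A g \<gamma>)"
proof -
  have contg: "continuous_on {0..1} \<gamma>" using \<gamma> by (simp add: C1_path_def path_def)
  show ?thesis
    unfolding continuous_on_eq_continuous_within
  proof
    fix t :: real assume t: "t \<in> {0..1}"
    obtain c where c: "c \<in> A" "\<gamma> t \<in> dom_of c" using atlas_cover[OF A] by blast
    have ch: "is_chart c" using A c atlas_chart by blast
    let ?S = "{t\<in>{0..1}. \<gamma> t \<in> dom_of c}"
    have cS: "continuous_on ?S \<gamma>" by (rule continuous_on_subset[OF contg]) auto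
    have "continuous_on ?S (\<lambda>s. g c (chart_inv c ((coord c \<circ> \<gamma>) s)) (velocity c \<gamma> s) (velocity c \<gamma> s))"
      by (rule metric_continuous[OF A g c(1)])
         (use C1_path_velocity(1)[OF \<gamma> c(1)] continuous_on_compose[OF cS
           continuous_on_subset[OF continuous_on_coord[OF ch]]] in auto)
    then have "continuous_on ?S (\<lambda>s. g c (\<gamma> s) (velocity c \<gamma> s) (velocity c \<gamma> s))"
      by (rule continuous_on_eq) (simp add: chart_inv_coord[OF ch])
    then have "continuous_on ?S (\<lambda>s. sqrt (g c (\<gamma> s) (velocity c \<gamma> s) (velocity c \<gamma> s)))"
      by (rule continuous_on_real_sqrt)
    then have "continuous_on ?S (riemannian_speed A g \<gamma>)"
      by (rule continuous_on_eq) (simp add: riemannian_speed_chart[OF A g \<gamma> c(1)])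
    then have cont: "continuous (at t within ?S) (riemannian_speed A g \<gamma>)"
      using t c by (simp add: continuous_on_eq_continuous_within)
    have "openin (top_of_set {0..1}) ({0..1} \<inter> \<gamma> -` dom_of c)"
      by (rule continuous_openin_preimage_gen[OF contg]) (use ch in \<open>simp add: is_chart_def\<close>)
    then obtain O' where O': "open O'" "{0..1} \<inter> \<gamma> -` dom_of c = {0..1} \<inter> O'"
      unfolding openin_open by blast
    have "at t within ?S = at t within {0..1}"
    proof (rule at_within_nhd[OF _ O'(1)])
      show "t \<in> O'" using t c O'(2) by blast
      show "?S \<inter> O' - {t} = {0..1} \<inter> O' - {t}" using O'(2) by blast
    qed
    with cont show "continuous (at t within {0..1}) (riemannian_speed A g \<gamma>)" by metis
  qed
qed

lemma riemannian_speed_nonneg: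
  fixes A :: "'a::metric_space chart set"
  assumes A: "smooth_atlas A" and g: "riemannian_metric A g" and \<gamma>: "C1_path A \<gamma>" and t: "t \<in> {0..1}"
  shows "riemannian_speed A g \<gamma> t \<ge> 0"
proof -
  obtain c where c: "c \<in> A" "\<gamma> t \<in> dom_of c" using atlas_cover[OF A] by blast
  then show ?thesis
    using riemannian_speed_chart[OF A g \<gamma> c(1) t c(2)] metric_bilinear(2)[OF g c] by simp
qed

lemma riemannian_length_nonneg:
  fixes A :: "'a::metric_space chart set"
  assumes A: "smooth_atlas A" and g: "riemannian_metric A g" and \<gamma>: "C1_path A \<gamma>"
  shows "riemannian_length A g \<gamma> \<ge> 0"
  unfolding riemannian_length_def
  by (intro integral_nonneg integrable_continuous_real riemannian_speed_continuous[OF A g \<gamma>]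
      riemannian_speed_nonneg[OF A g \<gamma>])

lemma dist_le_length:
  fixes A :: "'a::metric_space chart set"
  assumes A: "smooth_atlas A" and g: "riemannian_metric A g" and d: "riemannian_distance A g"
    and \<gamma>: "C1_path A \<gamma>"
  shows "dist (\<gamma> 0) (\<gamma> 1) \<le> riemannian_length A g \<gamma>"
proof -
  have mem: "\<gamma> \<in> C1_paths_between A (\<gamma> 0) (\<gamma> 1)"
    using \<gamma> by (simp add: C1_paths_between_def pathstart_def pathfinish_def)
  then have "dist (\<gamma> 0) (\<gamma> 1) = (INF \<gamma>\<in>C1_paths_between A (\<gamma> 0) (\<gamma> 1). riemannian_length A g \<gamma>)"
    using d unfolding riemannian_distance_def by blast
  also have "\<dots> \<le> riemannian_length A g \<gamma>"
    by (rule cINF_lower[OF _ mem])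
       (auto simp: C1_paths_between_def intro!: bdd_belowI2[of _ 0] riemannian_length_nonneg[OF A g])
  finally show ?thesis .
qed

lemma dist_less_length:
  fixes A :: "'a::metric_space chart set"
  assumes d: "riemannian_distance A g" and ne: "C1_paths_between A x y \<noteq> {}" and a: "dist x y < a"
  obtains \<gamma> where "\<gamma> \<in> C1_paths_between A x y" "riemannian_length A g \<gamma> < a"
proof -
  have "(INF \<gamma>\<in>C1_paths_between A x y. riemannian_length A g \<gamma>) < a"
    using d ne a unfolding riemannian_distance_def by simp
  then obtain z where "z \<in> riemannian_length A g ` C1_paths_between A x y" "z < a"
    using cInf_lessD[of "riemannian_length A g ` C1_paths_between A x y" a] ne by blast
  then show ?thesis using that by blast
qed

text \<open>Initial parts of a path are again competitors for the distance and are no longer than the path.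
  Hence a path shorter than \<open>a\<close> never leaves the ball of radius \<open>a\<close> about its starting point,
  and lengths need only be compared inside a chart.\<close>

lemma C1_path_initial_part:
  fixes A :: "'a::metric_space chart set"
  assumes A: "smooth_atlas A" and g: "riemannian_metric A g" and \<gamma>: "C1_path A \<gamma>" and \<tau>: "\<tau> \<in> {0..1}"
  shows "C1_path A (\<lambda>t. \<gamma> (\<tau> * t))"
    and "riemannian_length A g (\<lambda>t. \<gamma> (\<tau> * t)) \<le> riemannian_length A g \<gamma>"
proof -
  let ?m = "\<lambda>t. \<tau> * t"
  have m01: "?m t \<in> {0..1}" if "t \<in> {0..1}" for t using that \<tau> by (auto intro: mult_le_one)
  have contg: "continuous_on {0..1} \<gamma>" using \<gamma> by (simp add: C1_path_def path_def)
  have path: "path (\<lambda>t. \<gamma> (?m t))"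
    unfolding path_def
    by (rule continuous_on_compose2[OF contg]) (use m01 in \<open>auto intro: continuous_intros\<close>)
  have vd: "((coord c \<circ> (\<lambda>t. \<gamma> (?m t))) has_vector_derivative \<tau> *\<^sub>R velocity c \<gamma> (?m t)) (at t within {0..1})"
    if c: "c \<in> A" and t: "t \<in> {0..1}" and q: "\<gamma> (?m t) \<in> dom_of c" for c t
  proof -
    have "((coord c \<circ> \<gamma>) \<circ> ?m has_vector_derivative \<tau> *\<^sub>R velocity c \<gamma> (?m t)) (at t within {0..1})"
    proof (rule vector_diff_chain_within)
      show "((*) \<tau> has_vector_derivative \<tau>) (at t within {0..1})"
        by (auto intro!: derivative_eq_intros simp: has_real_derivative_iff_has_vector_derivative[symmetric])
      show "(coord c \<circ> \<gamma> has_vector_derivative velocity c \<gamma> (?m t)) (at (?m t) within (*) \<tau> ` {0..1})"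
        by (rule has_vector_derivative_within_subset[OF C1_path_velocity(2)[OF \<gamma> c m01[OF t] q]])
           (use m01 in auto)
    qed
    then show ?thesis by (simp add: o_def)
  qed
  show C1: "C1_path A (\<lambda>t. \<gamma> (?m t))"
    unfolding C1_path_def
  proof (intro conjI ballI path)
    fix c assume c: "c \<in> A"
    have "continuous_on {t\<in>{0..1}. \<gamma> (?m t) \<in> dom_of c} (\<lambda>t. \<tau> *\<^sub>R velocity c \<gamma> (?m t))"
      by (intro continuous_intros continuous_on_compose2[OF C1_path_velocity(1)[OF \<gamma> c], where f="?m"])
         (use m01 in auto)
    with vd[OF c] show "\<exists>D. continuous_on {t\<in>{0..1}. \<gamma> (?m t) \<in> dom_of c} D \<and>
        (\<forall>t\<in>{0..1}. \<gamma> (?m t) \<in> dom_of c \<longrightarrow>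
           ((coord c \<circ> (\<lambda>t. \<gamma> (?m t))) has_vector_derivative D t) (at t within {0..1}))"
      by (intro exI[of _ "\<lambda>t. \<tau> *\<^sub>R velocity c \<gamma> (?m t)"]) auto
  qed
  have speed: "riemannian_speed A g (\<lambda>t. \<gamma> (?m t)) t = \<tau> * riemannian_speed A g \<gamma> (?m t)"
    if t: "t \<in> {0..1}" for t
  proof -
    obtain c where c: "c \<in> A" "\<gamma> (?m t) \<in> dom_of c" using atlas_cover[OF A] by blast
    have v: "velocity c (\<lambda>t. \<gamma> (?m t)) t = \<tau> *\<^sub>R velocity c \<gamma> (?m t)"
      by (rule velocity_eqI[OF vd[OF c(1) t c(2)] t])
    have b: "g c (\<gamma> (?m t)) (\<tau> *\<^sub>R u) (\<tau> *\<^sub>R u) = \<tau>\<^sup>2 * g c (\<gamma> (?m t)) u u" for u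
      using metric_bilinear(1)[OF g c] by (simp add: bilinear_lmul bilinear_rmul power2_eq_square)
    show ?thesis
      using riemannian_speed_chart[OF A g C1 c(1) t] riemannian_speed_chart[OF A g \<gamma> c(1) m01[OF t]] c(2) \<tau>
      by (simp add: v b real_sqrt_mult)
  qed
  have int: "riemannian_speed A g \<gamma> integrable_on {0..1}"
    by (intro integrable_continuous_real riemannian_speed_continuous[OF A g \<gamma>])
  have "((\<lambda>t. \<tau> *\<^sub>R riemannian_speed A g \<gamma> (?m t)) has_integral
          integral {?m 0..?m 1} (riemannian_speed A g \<gamma>)) {0..1}"
  proof (rule has_integral_substitution[where c=0 and d=1])
    show "((*) \<tau> has_real_derivative \<tau>) (at x within {0..1})" for x :: real
      by (auto intro!: derivative_eq_intros)
  qed (use \<tau> m01 riemannian_speed_continuous[OF A g \<gamma>] in auto)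
  then have "riemannian_length A g (\<lambda>t. \<gamma> (?m t)) = integral {0..\<tau>} (riemannian_speed A g \<gamma>)"
    unfolding riemannian_length_def
    by (intro integral_unique) (rule has_integral_eq, use speed in auto)
  also have "\<dots> \<le> riemannian_length A g \<gamma>"
    unfolding riemannian_length_def
    by (intro integral_subset_le int integrable_on_subinterval[OF int])
       (use \<tau> riemannian_speed_nonneg[OF A g \<gamma>] in auto)
  finally show "riemannian_length A g (\<lambda>t. \<gamma> (?m t)) \<le> riemannian_length A g \<gamma>" .
qed

lemma short_path_in_ball:
  fixes A :: "'a::metric_space chart set"
  assumes A: "smooth_atlas A" and g: "riemannian_metric A g" and d: "riemannian_distance A g"
    and \<gamma>: "C1_path A \<gamma>" and len: "riemannian_length A g \<gamma> < a" and t: "t \<in> {0..1}"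
  shows "\<gamma> t \<in> ball (\<gamma> 0) a"
proof -
  have "dist (\<gamma> 0) (\<gamma> t) \<le> riemannian_length A g (\<lambda>s. \<gamma> (t * s))"
    using dist_le_length[OF A g d C1_path_initial_part(1)[OF A g \<gamma> t]] by simp
  also have "\<dots> < a" using C1_path_initial_part(2)[OF A g \<gamma> t] len by linarith
  finally show ?thesis by simp
qed

section \<open>Small balls are star-shaped in smooth charts\<close>

lemma C1_lipschitz_cball:
  fixes G :: "real^2 \<Rightarrow> real"
  assumes G: "Ck_on (Suc 0) G S" and S: "cball y0 r \<subseteq> S"
  obtains B where "B \<ge> 0" "\<And>y z. y \<in> cball y0 r \<Longrightarrow> z \<in> cball y0 r \<Longrightarrow> \<bar>G y - G z\<bar> \<le> B * norm (y - z)"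
proof -
  let ?G' = "\<lambda>x. frechet_derivative G (at x)"
  let ?b = "\<lambda>x. \<bar>?G' x (axis 1 1)\<bar> + \<bar>?G' x (axis 2 1)\<bar>"
  have "continuous_on (cball y0 r) ?b"
    using G S unfolding Ck_on_1 by (intro continuous_intros) (blast intro: continuous_on_subset)+
  then have "bounded (?b ` cball y0 r)"
    using compact_continuous_image compact_cball compact_imp_bounded by blast
  then obtain B where B: "B > 0" "\<And>x. x \<in> cball y0 r \<Longrightarrow> ?b x \<le> B"
    by (fastforce simp: bounded_pos)
  have der: "(G has_derivative ?G' x) (at x)" if "x \<in> cball y0 r" for x
    using G S that unfolding Ck_on_1 frechet_derivative_works by blast
  have "onorm (?G' x) \<le> B" if x: "x \<in> cball y0 r" for x
  proof (rule onorm_le)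
    fix v :: "real^2"
    have "?G' x v = v$1 *\<^sub>R ?G' x (axis 1 1) + v$2 *\<^sub>R ?G' x (axis 2 1)"
      by (rule linear_real2_expand[OF has_derivative_linear[OF der[OF x]]])
    then have "\<bar>?G' x v\<bar> \<le> \<bar>v$1\<bar> * \<bar>?G' x (axis 1 1)\<bar> + \<bar>v$2\<bar> * \<bar>?G' x (axis 2 1)\<bar>"
      by (simp add: abs_mult[symmetric])
    also have "\<dots> \<le> norm v * \<bar>?G' x (axis 1 1)\<bar> + norm v * \<bar>?G' x (axis 2 1)\<bar>"
      by (intro add_mono mult_right_mono component_le_norm_cart) auto
    also have "\<dots> = norm v * ?b x" by (simp add: algebra_simps)
    also have "\<dots> \<le> norm v * B" by (intro mult_left_mono B x) auto
    finally show "norm (?G' x v) \<le> B * norm v" by (simp add: mult.commute)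
  qed
  then have "norm (G y - G z) \<le> B * norm (y - z)" if "y \<in> cball y0 r" "z \<in> cball y0 r" for y z
    using that der by (intro differentiable_bound[of "cball y0 r" G ?G'])
      (auto intro: has_derivative_at_withinI)
  then show ?thesis using B(1) by (intro that[of B]) auto
qed

text \<open>If \<open>B\<close> is a Lipschitz constant of the metric and \<open>m\<close> a lower bound for it, then moving
  from \<open>y\<close> to \<open>y0 + s (y - y0)\<close> with \<open>B \<bar>y - y0\<bar> \<le> m\<close> multiplies the squared norm of a vector by at most
  \<open>1 + (1 - s) = 2 - s\<close>, and \<open>s\<^sup>2 (2 - s) \<le> 1\<close>.\<close>

lemma metric_radial_monotone:
  fixes A :: "'a::topological_space chart set"
  assumes A: "smooth_atlas A" and g: "riemannian_metric A g" and c: "c \<in> A"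
    and y0: "y0 \<in> coord c ` dom_of c"
  obtains r where "r > 0" "cball y0 r \<subseteq> coord c ` dom_of c"
    "\<And>y s v. y \<in> cball y0 r \<Longrightarrow> s \<in> {0..1} \<Longrightarrow>
       s\<^sup>2 * g c (chart_inv c (y0 + s *\<^sub>R (y - y0))) v v \<le> g c (chart_inv c y) v v"
proof -
  have ch: "is_chart c" using A c by (rule atlas_chart)
  define Q where "Q y v = g c (chart_inv c y) v v" for y v
  define G where "G i j y = g c (chart_inv c y) (axis i 1) (axis j 1)" for i j :: 2 and y
  obtain R where R: "R > 0" "cball y0 R \<subseteq> coord c ` dom_of c"
    using ch y0 unfolding is_chart_def open_contains_cball by blast
  have bil: "bilinear (g c (chart_inv c y))" and pos: "v \<noteq> 0 \<Longrightarrow> Q y v > 0"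
    if "y \<in> cball y0 R" for y v
  proof -
    have q: "chart_inv c y \<in> dom_of c" using coord_chart_inv(2)[OF ch] R(2) that by blast
    show "bilinear (g c (chart_inv c y))" by (rule metric_bilinear(1)[OF g c q])
    show "v \<noteq> 0 \<Longrightarrow> Q y v > 0" unfolding Q_def by (rule metric_bilinear(3)[OF g c q])
  qed
  define lip where "lip i j B \<longleftrightarrow> B \<ge> 0 \<and> (\<forall>y\<in>cball y0 R. \<forall>z\<in>cball y0 R. \<bar>G i j y - G i j z\<bar> \<le> B * norm (y - z))"
    for i j B
  have "\<exists>B. lip i j B" for i j
    unfolding lip_def G_def by (rule C1_lipschitz_cball[OF metric_coeff_C1[OF g c] R(2)]) blast
  then obtain b where "\<And>i j. lip i j (b i j)" by metis
  then have b: "\<And>i j. b i j \<ge> 0"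
    "\<And>i j y z. y \<in> cball y0 R \<Longrightarrow> z \<in> cball y0 R \<Longrightarrow> \<bar>G i j y - G i j z\<bar> \<le> b i j * norm (y - z)"
    unfolding lip_def by blast+
  define B where "B = b 1 1 + b 1 2 + b 2 1 + b 2 2"
  have B: "\<bar>Q y v - Q z v\<bar> \<le> B * norm (y - z) * (norm v)\<^sup>2"
    if yz: "y \<in> cball y0 R" "z \<in> cball y0 R" for y z v
  proof -
    have t: "\<bar>v$i * v$j * (G i j y - G i j z)\<bar> \<le> (norm v)\<^sup>2 * (b i j * norm (y - z))" for i j
      unfolding abs_mult power2_eq_square
      by (intro mult_mono component_le_norm_cart b yz mult_nonneg_nonneg) auto
    have "Q y v - Q z v = v$1 * v$1 * (G 1 1 y - G 1 1 z) + v$1 * v$2 * (G 1 2 y - G 1 2 z)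
       + v$2 * v$1 * (G 2 1 y - G 2 1 z) + v$2 * v$2 * (G 2 2 y - G 2 2 z)"
      unfolding Q_def bilinear_real2_expand[OF bil[OF yz(1)], of v] bilinear_real2_expand[OF bil[OF yz(2)], of v]
      by (simp add: G_def algebra_simps)
    then have "\<bar>Q y v - Q z v\<bar> \<le> (norm v)\<^sup>2 * (b 1 1 * norm (y - z)) + (norm v)\<^sup>2 * (b 1 2 * norm (y - z))
       + (norm v)\<^sup>2 * (b 2 1 * norm (y - z)) + (norm v)\<^sup>2 * (b 2 2 * norm (y - z))"
      using t[of 1 1] t[of 1 2] t[of 2 1] t[of 2 2] by linarith
    then show ?thesis by (simp add: B_def algebra_simps)
  qed
  obtain m where m: "m > 0" "\<And>y v. y \<in> cball y0 R \<Longrightarrow> m * (norm v)\<^sup>2 \<le> Q y v"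
  proof -
    let ?S = "cball y0 R \<times> sphere (0::real^2) 1"
    have "continuous_on ?S (\<lambda>t. g c (chart_inv c (fst t)) (snd t) (snd t))"
      by (rule metric_continuous[OF A g c]) (use R(2) in \<open>auto intro!: continuous_intros\<close>)
    then have "continuous_on ?S (\<lambda>t. Q (fst t) (snd t))" by (simp add: Q_def)
    moreover have "compact ?S" by (intro compact_Times) auto
    moreover have "(y0, axis 1 1) \<in> ?S" using R by (simp add: norm_axis_1)
    ultimately obtain t where t: "t \<in> ?S" "\<And>u. u \<in> ?S \<Longrightarrow> Q (fst t) (snd t) \<le> Q (fst u) (snd u)"
      using continuous_attains_inf[of ?S "\<lambda>t. Q (fst t) (snd t)"] by blast
    let ?m = "Q (fst t) (snd t)"
    have m0: "?m > 0" using t(1) by (intro pos) auto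
    have "?m * (norm v)\<^sup>2 \<le> Q y v" if y: "y \<in> cball y0 R" for y v
    proof (cases "v = 0")
      case True then show ?thesis using bilinear_lzero[OF bil[OF y]] by (simp add: Q_def)
    next
      case False
      have "?m \<le> Q y (v /\<^sub>R norm v)" using t(2)[of "(y, v /\<^sub>R norm v)"] y False by simp
      also have "\<dots> = Q y v / (norm v)\<^sup>2"
        using bilinear_lmul[OF bil[OF y]] bilinear_rmul[OF bil[OF y]]
        by (simp add: Q_def power2_eq_square field_simps)
      finally show ?thesis using False by (simp add: field_simps)
    qed
    with m0 that show ?thesis by blast
  qed
  have B0: "B \<ge> 0" using b(1) by (simp add: B_def)
  define r where "r = min R (m / (B + 1))"
  have r: "r > 0" "r \<le> R" using R m B0 by (auto simp: r_def)
  have Br: "B * r \<le> m"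
  proof -
    have "B * r \<le> (B + 1) * (m / (B + 1))"
      using B0 r m by (intro mult_mono) (auto simp: r_def)
    then show ?thesis using B0 by simp
  qed
  show ?thesis
  proof
    show "r > 0" by (fact r)
    show "cball y0 r \<subseteq> coord c ` dom_of c" using r R by auto
    fix y s and v :: "real^2" assume y: "y \<in> cball y0 r" and s: "s \<in> {0..1::real}"
    let ?z = "y0 + s *\<^sub>R (y - y0)"
    have ny: "norm (y - y0) \<le> r" using y by (simp add: dist_norm norm_minus_commute)
    have "norm (?z - y0) \<le> 1 * norm (y - y0)" using s by (simp add: mult_left_le_one_le)
    then have z: "?z \<in> cball y0 R" using ny r by (simp add: dist_norm norm_minus_commute)
    have yR: "y \<in> cball y0 R" using y r by auto
    have "?z - y = (1 - s) *\<^sub>R (y0 - y)" by (simp add: algebra_simps)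
    then have nz: "norm (?z - y) \<le> (1 - s) * r"
      using s ny by (simp add: norm_minus_commute mult_left_mono)
    have "B * norm (?z - y) * (norm v)\<^sup>2 \<le> B * ((1 - s) * r) * (norm v)\<^sup>2"
      by (intro mult_right_mono mult_left_mono nz B0) auto
    also have "\<dots> = (1 - s) * ((B * r) * (norm v)\<^sup>2)" by simp
    also have "\<dots> \<le> (1 - s) * (m * (norm v)\<^sup>2)"
      using s by (intro mult_left_mono mult_right_mono Br) auto
    also have "\<dots> \<le> (1 - s) * Q y v" using s by (intro mult_left_mono m(2) yR) auto
    finally have "Q ?z v \<le> (2 - s) * Q y v" using B[OF z yR, of v] by (simp add: algebra_simps)
    then have "s\<^sup>2 * Q ?z v \<le> s\<^sup>2 * ((2 - s) * Q y v)" by (intro mult_left_mono) auto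
    also have "\<dots> = Q y v - (1 - s) * (1 + s * (1 - s)) * Q y v"
      by (simp add: algebra_simps power2_eq_square)
    also have "\<dots> \<le> Q y v"
    proof -
      have "Q y v \<ge> 0" using pos[OF yR, of v] bilinear_lzero[OF bil[OF yR]] by (cases "v = 0") (auto simp: Q_def)
      then have "0 \<le> (1 - s) * (1 + s * (1 - s)) * Q y v"
        using s by (intro mult_nonneg_nonneg add_nonneg_nonneg) auto
      then show ?thesis by linarith
    qed
    finally show "s\<^sup>2 * g c (chart_inv c ?z) v v \<le> g c (chart_inv c y) v v" by (simp add: Q_def)
  qed
qed

text \<open>Contracting a short path towards \<open>p\<close> does not increase its speed at any time, by
  \<open>metric_radial_monotone\<close>; so its end point stays in the ball while it moves to \<open>p\<close>.\<close>

lemma small_ball_starlike: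
  fixes A :: "'a::metric_space chart set"
  assumes A: "smooth_atlas A" and g: "riemannian_metric A g" and d: "riemannian_distance A g"
    and c: "c \<in> A" and p: "p \<in> dom_of c"
  shows "\<exists>a0>0. \<forall>a. 0 < a \<and> a < a0 \<longrightarrow> ball p a \<subseteq> dom_of c \<and> starlike (coord c ` ball p a)"
proof -
  have ch: "is_chart c" using A c by (rule atlas_chart)
  define y0 where "y0 = coord c p"
  have y0: "y0 \<in> coord c ` dom_of c" using p by (simp add: y0_def)
  have p0: "chart_inv c y0 = p" using chart_inv_coord[OF ch p] by (simp add: y0_def)
  obtain r where r: "r > 0" "cball y0 r \<subseteq> coord c ` dom_of c"
    "\<And>y s v. y \<in> cball y0 r \<Longrightarrow> s \<in> {0..1} \<Longrightarrow>
       s\<^sup>2 * g c (chart_inv c (y0 + s *\<^sub>R (y - y0))) v v \<le> g c (chart_inv c y) v v"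
    using metric_radial_monotone[OF A g c y0] by metis
  have seg: "y0 + s *\<^sub>R (y - y0) \<in> cball y0 r" if "y \<in> cball y0 r" "s \<in> {0..1}" for y s
  proof -
    have "norm (s *\<^sub>R (y - y0)) \<le> norm (y - y0)" using that by (simp add: mult_left_le_one_le)
    then show ?thesis using that by (simp add: dist_norm norm_minus_commute)
  qed
  have "open (dom_of c \<inter> coord c -` ball y0 r)" by (rule open_coord_vimage[OF ch open_ball])
  moreover have "p \<in> dom_of c \<inter> coord c -` ball y0 r" using p r by (simp add: y0_def)
  ultimately obtain a0 where a0: "a0 > 0" "ball p a0 \<subseteq> dom_of c \<inter> coord c -` ball y0 r"
    using open_contains_ball by blast
  have scale: "chart_inv c (y0 + s *\<^sub>R (coord c x - y0)) \<in> ball p a"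
    if a: "0 < a" "a < a0" and x: "x \<in> ball p a" and s: "s \<in> {0..1}" for a s x
  proof -
    have near: "z \<in> dom_of c" "coord c z \<in> cball y0 r" if "z \<in> ball p a" for z
    proof -
      have "z \<in> ball p a0" using that a by simp
      with a0(2) show "z \<in> dom_of c" "coord c z \<in> cball y0 r" by auto
    qed
    have "C1_path A (chart_inv c \<circ> (\<lambda>t. y0 + t *\<^sub>R (coord c x - y0)))"
      by (rule C1_path_in_chart[OF A c, where \<eta>'="\<lambda>t. coord c x - y0"])
         (use seg[OF near(2)[OF x]] r(2) in \<open>auto intro!: derivative_eq_intros\<close>)
    moreover have "chart_inv c (coord c x) = x" using chart_inv_coord[OF ch near(1)[OF x]] .
    ultimately have "chart_inv c \<circ> (\<lambda>t. y0 + t *\<^sub>R (coord c x - y0)) \<in> C1_paths_between A p x"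
      using p0 by (simp add: C1_paths_between_def pathstart_def pathfinish_def)
    then have "C1_paths_between A p x \<noteq> {}" by blast
    then obtain \<gamma> where "\<gamma> \<in> C1_paths_between A p x" and len: "riemannian_length A g \<gamma> < a"
      using dist_less_length[OF d, of p x a] x by auto
    then have \<gamma>: "C1_path A \<gamma>" "\<gamma> 0 = p" "\<gamma> 1 = x"
      by (auto simp: C1_paths_between_def pathstart_def pathfinish_def)
    have \<gamma>a: "\<gamma> t \<in> ball p a" if "t \<in> {0..1}" for t
      using short_path_in_ball[OF A g d \<gamma>(1) len that] \<gamma>(2) by simp
    define \<eta> where "\<eta> t = y0 + s *\<^sub>R (coord c (\<gamma> t) - y0)" for t
    have \<eta>: "\<eta> t \<in> coord c ` dom_of c" if "t \<in> {0..1}" for t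
      using seg[OF near(2)[OF \<gamma>a[OF that]] s] r(2) by (auto simp: \<eta>_def)
    have der: "(\<eta> has_vector_derivative s *\<^sub>R velocity c \<gamma> t) (at t within {0..1})"
      if "t \<in> {0..1}" for t
    proof -
      have "((\<lambda>t. y0 + s *\<^sub>R ((coord c \<circ> \<gamma>) t - y0)) has_vector_derivative s *\<^sub>R velocity c \<gamma> t) (at t within {0..1})"
        using C1_path_velocity(2)[OF \<gamma>(1) c that near(1)[OF \<gamma>a[OF that]]]
        by (auto intro!: derivative_eq_intros simp del: comp_apply)
      then show ?thesis by (simp add: \<eta>_def[abs_def])
    qed
    have "{t\<in>{0..1}. \<gamma> t \<in> dom_of c} = {0..1}" using near(1)[OF \<gamma>a] by auto
    then have cv: "continuous_on {0..1} (velocity c \<gamma>)" using C1_path_velocity(1)[OF \<gamma>(1) c] by simp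
    have C1: "C1_path A (chart_inv c \<circ> \<eta>)"
      and v: "\<And>t. t \<in> {0..1} \<Longrightarrow> velocity c (chart_inv c \<circ> \<eta>) t = s *\<^sub>R velocity c \<gamma> t"
      by (rule C1_path_in_chart[OF A c \<eta> der]; (intro continuous_intros cv | assumption))+
    have "riemannian_length A g (chart_inv c \<circ> \<eta>) \<le> riemannian_length A g \<gamma>"
      unfolding riemannian_length_def
    proof (intro integral_le integrable_continuous_real riemannian_speed_continuous[OF A g] C1 \<gamma>(1))
      fix t :: real assume t: "t \<in> {0..1}"
      let ?z = "chart_inv c (\<eta> t)" and ?u = "velocity c \<gamma> t"
      have z: "?z \<in> dom_of c" using coord_chart_inv(2)[OF ch \<eta>[OF t]] .
      have "g c ?z (s *\<^sub>R ?u) (s *\<^sub>R ?u) = s\<^sup>2 * g c ?z ?u ?u"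
        using metric_bilinear(1)[OF g c z] by (simp add: bilinear_lmul bilinear_rmul power2_eq_square)
      also have "\<dots> \<le> g c (chart_inv c (coord c (\<gamma> t))) ?u ?u"
        unfolding \<eta>_def by (rule r(3)[OF near(2)[OF \<gamma>a[OF t]] s])
      also have "chart_inv c (coord c (\<gamma> t)) = \<gamma> t"
        by (rule chart_inv_coord[OF ch near(1)[OF \<gamma>a[OF t]]])
      finally show "riemannian_speed A g (chart_inv c \<circ> \<eta>) t \<le> riemannian_speed A g \<gamma> t"
        using riemannian_speed_chart[OF A g C1 c t] riemannian_speed_chart[OF A g \<gamma>(1) c t near(1)[OF \<gamma>a[OF t]]] z
        by (simp add: v[OF t])
    qed
    moreover have "\<eta> 0 = y0" by (simp add: \<eta>_def \<gamma>(2) y0_def)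
    ultimately have "dist p (chart_inv c (\<eta> 1)) < a"
      using dist_le_length[OF A g d C1] len p0 by simp
    then show ?thesis by (simp add: \<eta>_def \<gamma>(3))
  qed
  have "ball p a \<subseteq> dom_of c \<and> starlike (coord c ` ball p a)" if a: "0 < a" "a < a0" for a
  proof
    have "ball p a \<subseteq> ball p a0" using a by auto
    with a0(2) show sub: "ball p a \<subseteq> dom_of c" by auto
    have near: "coord c z \<in> cball y0 r" if "z \<in> ball p a" for z
      using that a0(2) \<open>ball p a \<subseteq> ball p a0\<close> by force
    show "starlike (coord c ` ball p a)"
      unfolding starlike_def
    proof (intro bexI ballI)
      show "y0 \<in> coord c ` ball p a" using a by (auto simp: y0_def)
      fix y assume "y \<in> coord c ` ball p a"
      then obtain x where x: "x \<in> ball p a" "y = coord c x" by blast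
      show "closed_segment y0 y \<subseteq> coord c ` ball p a"
      proof
        fix w assume "w \<in> closed_segment y0 y"
        then obtain s where s: "s \<in> {0..1}" "w = y0 + s *\<^sub>R (y - y0)"
          by (auto simp: closed_segment_def algebra_simps)
        then have "w \<in> coord c ` dom_of c" using seg[OF near[OF x(1)] s(1)] r(2) x by auto
        then have "coord c (chart_inv c w) = w" by (rule coord_chart_inv(1)[OF ch])
        then show "w \<in> coord c ` ball p a"
          using scale[OF a x(1) s(1)] s(2) x(2) by (metis image_eqI)
      qed
    qed
  qed
  then show ?thesis using a0(1) by blast
qed

section \<open>A segment of the axis separates a contractible plane domain into two sides\<close>

text \<open>The argument is topological and local at \<open>T\<close>. Each point of \<open>T\<close> has an upper and a lower
  half-disc; the component of \<open>D - T\<close> containing the upper one is locally constant along \<open>T\<close>, hence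
  constant, and likewise below. The square root described at the top shows that the two
  components are different. The point \<open>q\<close> of the axis makes the distance to the rest of the axis
  meaningful.\<close>

lemma axis_separation:
  fixes D T :: "(real^2) set"
  assumes D: "open D" "contractible D" and T: "connected T" "p \<in> T" "T \<subseteq> D" "\<And>z. z \<in> T \<Longrightarrow> z $ 2 = 0"
    and clT: "\<And>z. z \<in> D \<Longrightarrow> z \<in> closure T \<Longrightarrow> z \<in> T"
    and nb: "\<And>z. z \<in> T \<Longrightarrow> \<exists>e>0. ball z e \<subseteq> D \<and> (\<forall>w\<in>ball z e. w $ 2 = 0 \<longrightarrow> w \<in> T)"
    and q: "q $ 2 = 0" "q \<notin> T"
  obtains P N where "P \<noteq> N" "components (D - T) = {P, N}" "open P" "open N"
    "\<And>z. z \<in> T \<Longrightarrow> \<exists>e>0. ball z e \<subseteq> D \<and>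
       (\<forall>w\<in>ball z e. (w $ 2 > 0 \<longrightarrow> w \<in> P) \<and> (w $ 2 < 0 \<longrightarrow> w \<in> N) \<and> (w $ 2 = 0 \<longrightarrow> w \<in> T))"
proof -
  define E2 :: "real^2" where "E2 = axis 2 1"
  have E2: "E2 $ 2 = 1" "norm E2 = 1" by (auto simp: E2_def norm_axis_1)
  obtain e where e: "\<And>z. z \<in> T \<Longrightarrow> e z > 0" "\<And>z. z \<in> T \<Longrightarrow> ball z (e z) \<subseteq> D"
     "\<And>z w. z \<in> T \<Longrightarrow> w \<in> ball z (e z) \<Longrightarrow> w $ 2 = 0 \<Longrightarrow> w \<in> T"
    using nb by metis
  define H where "H \<sigma> z = ball z (e z) \<inter> {w. \<sigma> * w $ 2 > 0}" for \<sigma> :: real and z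
  define side where "side \<sigma> z = connected_component_set (D - T) (z + (\<sigma> * e z / 2) *\<^sub>R E2)" for \<sigma> :: real and z
  have Hconn: "connected (H \<sigma> z)" for \<sigma> z
  proof -
    have "{w::real^2. \<sigma> * w $ 2 > 0} = {w. (\<sigma> *\<^sub>R E2) \<bullet> w > 0}"
      by (simp add: E2_def inner_axis' )
    then have "convex {w::real^2. \<sigma> * w $ 2 > 0}" by (simp only: convex_halfspace_gt)
    then show ?thesis unfolding H_def by (intro convex_connected convex_Int convex_ball)
  qed
  have Hsub: "H \<sigma> z \<subseteq> D - T" if "z \<in> T" for \<sigma> z
    using e(2)[OF that] T(4) by (force simp: H_def)
  have Hpt: "z + (\<sigma> * e z / 2) *\<^sub>R E2 \<in> H \<sigma> z" if "z \<in> T" "\<bar>\<sigma>\<bar> = 1" for \<sigma> z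
  proof -
    have "\<sigma> * \<sigma> = 1" using that(2) by (metis abs_mult_self_eq mult_1)
    then have "\<sigma> * (z + (\<sigma> * e z / 2) *\<^sub>R E2) $ 2 = e z / 2"
      using T(4)[OF that(1)] E2 by (simp add: algebra_simps)
    then show ?thesis using e(1)[OF that(1)] that E2 by (simp add: H_def dist_norm abs_mult)
  qed
  have Hside: "H \<sigma> z \<subseteq> side \<sigma> z" if "z \<in> T" "\<bar>\<sigma>\<bar> = 1" for \<sigma> z
    unfolding side_def by (rule connected_component_maximal[OF Hpt[OF that] Hconn Hsub[OF that(1)]])
  have side_comp: "side \<sigma> z \<in> components (D - T)" if "z \<in> T" "\<bar>\<sigma>\<bar> = 1" for \<sigma> z
    using Hpt[OF that] Hsub[OF that(1)] unfolding side_def components_def by blast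
  have comp_eq: "U = V" if "U \<in> components (D - T)" "V \<in> components (D - T)" "w \<in> U" "w \<in> V" for U V w
    using components_nonoverlap[OF that(1,2)] that by blast
  have side_local: "side \<sigma> z = side \<sigma> z'"
    if z: "z \<in> T" "z' \<in> T" "z' \<in> ball z (e z)" and \<sigma>: "\<bar>\<sigma>\<bar> = 1" for \<sigma> z z'
  proof -
    define t where "t = min (e z - dist z z') (e z') / 2"
    have t: "t > 0" "t < e z - dist z z'" "t < e z'" using z e(1)[OF z(2)] by (auto simp: t_def min_def)
    let ?w = "z' + (\<sigma> * t) *\<^sub>R E2"
    have ss: "\<sigma> * \<sigma> = 1" using \<sigma> by (metis abs_mult_self_eq mult_1)
    then have w2: "\<sigma> * ?w $ 2 = t" using T(4)[OF z(2)] E2 by (simp add: algebra_simps)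
    have d: "dist z' ?w = t" using t \<sigma> E2 by (simp add: dist_norm abs_mult)
    then have "?w \<in> H \<sigma> z'" using w2 t by (simp add: H_def)
    moreover have "?w \<in> H \<sigma> z"
      using dist_triangle[of z ?w z'] w2 t d by (simp add: H_def)
    ultimately show ?thesis
      using comp_eq[OF side_comp[OF z(1) \<sigma>] side_comp[OF z(2) \<sigma>]] Hside[OF z(1) \<sigma>] Hside[OF z(2) \<sigma>] by blast
  qed
  have side_const: "side \<sigma> z = side \<sigma> p" if z: "z \<in> T" and \<sigma>: "\<bar>\<sigma>\<bar> = 1" for \<sigma> z
  proof (rule connected_local_const[OF T(1) z T(2)], rule ballI)
    fix z1 assume z1: "z1 \<in> T"
    have "\<forall>\<^sub>F b in at z1 within T. b \<in> ball z1 (e z1)"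
      using e(1)[OF z1] unfolding eventually_at by (intro exI[of _ "e z1"]) (simp add: dist_commute)
    moreover have "\<forall>\<^sub>F b in at z1 within T. b \<in> T" by (simp add: eventually_at_filter)
    ultimately show "\<forall>\<^sub>F b in at z1 within T. side \<sigma> z1 = side \<sigma> b"
      by eventually_elim (use side_local[OF z1 _ _ \<sigma>] in blast)
  qed
  define P where "P = side 1 p"
  define N where "N = side (-1) p"
  have PN: "P \<in> components (D - T)" "N \<in> components (D - T)"
    unfolding P_def N_def using side_comp T(2) by simp_all
  have "D - T = D - closure T" using clT closure_subset[of T] by blast
  then have oDT: "open (D - T)" using D(1) by (simp add: open_Diff)
  have half: "ball z (e z) \<subseteq> D \<and>
       (\<forall>w\<in>ball z (e z). (w $ 2 > 0 \<longrightarrow> w \<in> P) \<and> (w $ 2 < 0 \<longrightarrow> w \<in> N) \<and> (w $ 2 = 0 \<longrightarrow> w \<in> T))"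
    if z: "z \<in> T" for z
    using e[OF z] Hside[OF z, of 1] Hside[OF z, of "-1"] side_const[OF z, of 1] side_const[OF z, of "-1"]
    unfolding P_def N_def H_def by auto
  have "C \<in> {P, N}" if C: "C \<in> components (D - T)" for C
  proof -
    have oC: "open C" using open_components[OF oDT C] .
    have CD: "C \<subseteq> D - T" "C \<noteq> {}" using in_components_subset[OF C] in_components_nonempty[OF C] by auto
    \<comment> \<open>A component whose closure misses \<open>T\<close> is open and closed in the connected set \<open>D\<close>.\<close>
    have "\<exists>z\<in>T. z \<in> closure C"
    proof (rule ccontr)
      assume no: "\<not> ?thesis"
      obtain F where F: "closed F" "C = (D - T) \<inter> F"
        using closedin_component[OF C] unfolding closedin_closed by blast
      then have "closure C \<subseteq> F" by (simp add: closure_minimal)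
      then have "w \<in> C" if "w \<in> D - T" "w \<in> closure C" for w
        using that F(2) by blast
      then have "D \<subseteq> C \<union> (D - closure C)" using no by blast
      moreover have "C \<inter> (D - closure C) \<inter> D = {}" using closure_subset[of C] by blast
      moreover have "connected D" by (rule contractible_imp_connected[OF D(2)])
      moreover have "open (D - closure C)" using D(1) by (simp add: open_Diff)
      moreover have "p \<in> (D - closure C) \<inter> D" using no T(2,3) by blast
      ultimately show False using oC CD unfolding connected_def by blast
    qed
    then obtain z where z: "z \<in> T" "z \<in> closure C" by blast
    then obtain w where w: "w \<in> C" "w \<in> ball z (e z)"
      using e(1)[OF z(1)] unfolding closure_approachable by (metis dist_commute mem_ball)
    then have "w \<notin> T" using CD by blast
    then have "w \<in> P \<or> w \<in> N" using half[OF z(1)] w(2) linorder_less_linear[of "w $ 2" 0] by blast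
    then show ?thesis using comp_eq[OF C PN(1) w(1)] comp_eq[OF C PN(2) w(1)] by blast
  qed
  then have comps: "components (D - T) = {P, N}" using PN by blast
  have "P \<noteq> N"
  proof
    assume PeqN: "P = N"
    define Ax where "Ax = {w::real^2. w $ 2 = 0} - T"
    have Ax: "Ax \<noteq> {}" "T \<noteq> {}" using q T(2) by (auto simp: Ax_def)
    \<comment> \<open>On the axis, the real part is positive on \<open>T\<close> and vanishes only at end points of \<open>T\<close>,
      which are not in \<open>D\<close>.\<close>
    define f where "f z = Complex (infdist z Ax - infdist z T) (z $ 2)" for z
    have contf: "continuous_on D f"
      unfolding f_def Complex_eq by (intro continuous_intros)
    have real_f: "z \<in> T" if z: "z \<in> D" "z $ 2 = 0" "infdist z Ax \<ge> infdist z T" for z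
    proof (rule ccontr)
      assume n: "z \<notin> T"
      then have "infdist z Ax = 0" using z by (intro infdist_zero) (simp add: Ax_def)
      then have "infdist z T = 0" using z(3) infdist_nonneg[of z T] by linarith
      then have "z \<in> closure T" using Ax by (simp add: in_closure_iff_infdist_zero)
      with clT z n show False by blast
    qed
    have f_pos: "Re (f z) > 0" if z: "z \<in> T" for z
    proof -
      have "infdist z Ax \<noteq> 0"
      proof
        assume "infdist z Ax = 0"
        then have "z \<in> closure Ax" using Ax by (simp add: in_closure_iff_infdist_zero)
        then obtain w where "w \<in> Ax" "dist w z < e z"
          using e(1)[OF z] unfolding closure_approachable by blast
        then have "w \<in> Ax" "w \<in> ball z (e z)" by (simp_all add: dist_commute)
        then show False using e(3)[OF z] by (auto simp: Ax_def)
      qed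
      then show ?thesis using z infdist_nonneg[of z Ax] by (simp add: f_def)
    qed
    have f0: "f z \<noteq> 0" if "z \<in> D" for z
    proof
      assume "f z = 0"
      then have "Re (f z) = 0" "Im (f z) = 0" by simp_all
      then have "z $ 2 = 0" "infdist z Ax = infdist z T" by (simp_all add: f_def)
      then have "z \<in> T" using real_f[OF that] by linarith
      from f_pos[OF this] \<open>Re (f z) = 0\<close> show False by linarith
    qed
    have "\<exists>h. continuous_on D h \<and> (\<forall>z\<in>D. f z = (h z)\<^sup>2)"
      by (rule continuous_sqrt_on_contractible[OF contf D(2) f0]) auto
    then obtain h where h: "continuous_on D h" "\<And>z. z \<in> D \<Longrightarrow> f z = (h z)\<^sup>2"
      by blast
    have Reh: "Re (f z) = (Re (h z))\<^sup>2 - (Im (h z))\<^sup>2" and Imh: "z $ 2 = 2 * Re (h z) * Im (h z)" if "z \<in> D" for z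
    proof -
      have "Im (f z) = z $ 2" by (simp add: f_def)
      then show "Re (f z) = (Re (h z))\<^sup>2 - (Im (h z))\<^sup>2" "z $ 2 = 2 * Re (h z) * Im (h z)"
        using h(2)[OF that] by (simp_all add: Re_power2 Im_power2)
    qed
    have Im0: "Im (h z) \<noteq> 0" if "z \<in> D - T" for z
    proof
      assume i: "Im (h z) = 0"
      have zD: "z \<in> D" using that by blast
      have "z $ 2 = 0" "Re (f z) \<ge> 0" using Imh[OF zD] Reh[OF zD] i by auto
      then have "z \<in> T" using real_f[OF zD] by (simp add: f_def)
      with that show False by blast
    qed
    have pD: "p \<in> D" using T by blast
    have Rep: "Re (h p) \<noteq> 0"
    proof
      assume "Re (h p) = 0"
      then have "Re (f p) = - (Im (h p))\<^sup>2" using Reh[OF pD] by simp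
      then show False using f_pos[OF T(2)] by simp
    qed
    have "continuous_on D (\<lambda>z. Re (h z))" by (intro continuous_intros h)
    then obtain d where d: "d > 0" "\<And>z. z \<in> D \<Longrightarrow> dist z p < d \<Longrightarrow> dist (Re (h z)) (Re (h p)) < \<bar>Re (h p)\<bar>"
    proof -
      have "\<bar>Re (h p)\<bar> > 0" using Rep by simp
      then show ?thesis using that pD \<open>continuous_on D (\<lambda>z. Re (h z))\<close> unfolding continuous_on_iff by blast
    qed
    define t where "t = min d (e p) / 2"
    have t: "t > 0" "t < d" "t < e p" using d e(1)[OF T(2)] by (auto simp: t_def min_def)
    \<comment> \<open>\<open>Re h\<close> keeps its sign near \<open>p\<close> and the height is \<open>2 * Re h * Im h\<close>, so \<open>Im h\<close> changes sign
      with the height.\<close>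
    have pt: "p + (\<sigma> * t) *\<^sub>R E2 \<in> H \<sigma> p \<and> (p + (\<sigma> * t) *\<^sub>R E2) $ 2 = \<sigma> * t \<and>
         Re (h p) * Re (h (p + (\<sigma> * t) *\<^sub>R E2)) > 0" if \<sigma>: "\<bar>\<sigma>\<bar> = 1" for \<sigma>
    proof -
      let ?w = "p + (\<sigma> * t) *\<^sub>R E2"
      have ss: "\<sigma> * \<sigma> = 1" using \<sigma> by (metis abs_mult_self_eq mult_1)
      have w2: "?w $ 2 = \<sigma> * t" using T(4)[OF T(2)] E2 by simp
      have dw: "dist p ?w = t" using t \<sigma> E2 by (simp add: dist_norm abs_mult)
      have H: "?w \<in> H \<sigma> p" using w2 dw t ss by (simp add: H_def mult.assoc[symmetric])
      then have "?w \<in> D" using Hsub[OF T(2)] by blast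
      moreover have "dist ?w p < d" using dw t by (simp add: dist_commute)
      ultimately have "dist (Re (h ?w)) (Re (h p)) < \<bar>Re (h p)\<bar>" by (rule d(2))
      then have "Re (h p) * Re (h ?w) > 0"
        unfolding dist_real_def zero_less_mult_iff by arith
      with H w2 show ?thesis by blast
    qed
    let ?u = "p + (1 * t) *\<^sub>R E2" and ?l = "p + ((-1) * t) *\<^sub>R E2"
    have uP: "?u \<in> P" using pt[of 1] Hside[OF T(2), of 1] unfolding P_def by auto
    have lP: "?l \<in> P" using pt[of "-1"] Hside[OF T(2), of "-1"] unfolding PeqN N_def by auto
    have PD: "P \<subseteq> D - T" using in_components_subset[OF PN(1)] .
    have uD: "?u \<in> D" and lD: "?l \<in> D" using uP lP PD by blast+
    have u: "?u $ 2 = 1 * t" "Re (h p) * Re (h ?u) > 0" using pt[of 1] by simp_all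
    have l: "?l $ 2 = (-1) * t" "Re (h p) * Re (h ?l) > 0" using pt[of "-1"] by simp_all
    have "0 < 2 * Re (h ?u) * Im (h ?u)" using Imh[OF uD] u(1) t(1) by linarith
    then have u': "0 < Re (h ?u) * Im (h ?u)" by linarith
    have "2 * Re (h ?l) * Im (h ?l) < 0" using Imh[OF lD] l(1) t(1) by linarith
    then have l': "Re (h ?l) * Im (h ?l) < 0" by linarith
    have opp: "Im (h ?u) * Im (h ?l) < 0"
      using u(2) l(2) u' l' unfolding zero_less_mult_iff mult_less_0_iff by argo
    have "continuous_on P (\<lambda>z. Im (h z))"
      using h(1) PD by (intro continuous_intros) (blast intro: continuous_on_subset)
    then have conn: "connected ((\<lambda>z. Im (h z)) ` P)"
      using connected_continuous_image in_components_connected[OF PN(1)] by blast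
    have "0 \<in> (\<lambda>z. Im (h z)) ` P"
    proof -
      have m: "Im (h ?u) \<in> (\<lambda>z. Im (h z)) ` P" "Im (h ?l) \<in> (\<lambda>z. Im (h z)) ` P" using uP lP by blast+
      consider "Im (h ?u) < 0 \<and> 0 < Im (h ?l)" | "Im (h ?l) < 0 \<and> 0 < Im (h ?u)"
        using opp unfolding mult_less_0_iff by blast
      then show ?thesis
        using connected_contains_Icc[OF conn m] connected_contains_Icc[OF conn m(2,1)]
        by cases (force simp: subset_iff)+
    qed
    then show False using Im0 PD by auto
  qed
  then show ?thesis
    using that[of P N] comps open_components[OF oDT PN(1)] open_components[OF oDT PN(2)] half e(1) by blast
qed

section \<open>Straightened curves and their sides\<close>

lemma homeomorphism_connected_component:
  assumes h: "homeomorphism S T f g" and x: "x \<in> S"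
  shows "f ` connected_component_set S x = connected_component_set T (f x)"
proof
  have sub: "f ` connected_component_set S x \<subseteq> connected_component_set T (f x)"
    if h: "homeomorphism S T f g" and x: "x \<in> S" for S :: "'x::topological_space set" and T :: "'y::topological_space set" and f g x
  proof (rule connected_component_maximal)
    have "connected_component_set S x \<subseteq> S" by (rule connected_component_subset)
    then show "connected (f ` connected_component_set S x)" "f ` connected_component_set S x \<subseteq> T"
      using h by (auto simp: homeomorphism_def intro: connected_continuous_image continuous_on_subset)
    show "f x \<in> f ` connected_component_set S x" using x by simp
  qed
  show "f ` connected_component_set S x \<subseteq> connected_component_set T (f x)" by (rule sub[OF h x])
  have fx: "f x \<in> T" and gfx: "g (f x) = x" using h x by (auto simp: homeomorphism_def)
  have "g ` connected_component_set T (f x) \<subseteq> connected_component_set S x"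
    using sub[OF homeomorphism_symD[OF h] fx] gfx by simp
  then have "f ` g ` connected_component_set T (f x) \<subseteq> f ` connected_component_set S x" by blast
  moreover have "f (g y) = y" if "y \<in> connected_component_set T (f x)" for y
    using h that connected_component_subset[of T "f x"] by (auto simp: homeomorphism_def)
  ultimately show "connected_component_set T (f x) \<subseteq> f ` connected_component_set S x"
    by force
qed

lemma homeomorphism_components:
  assumes h: "homeomorphism S T f g"
  shows "components T = image f ` components S"
proof -
  have T: "T = f ` S" using h by (simp add: homeomorphism_def)
  show ?thesis
    unfolding components_def T image_image
    using homeomorphism_connected_component[OF h] T by (auto simp: image_iff)
qed

definition straightens :: "'a::topological_space chart \<Rightarrow> 'a set \<Rightarrow> bool" where
  "straightens c K \<longleftrightarrow> is_chart c \<and> coord c ` (dom_of c \<inter> K) = {y \<in> coord c ` dom_of c. y $ 2 = 0}"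

lemma straightens_iff:
  assumes "straightens c K" "q \<in> dom_of c"
  shows "q \<in> K \<longleftrightarrow> coord c q $ 2 = 0"
proof -
  have eq: "coord c ` (dom_of c \<inter> K) = {y \<in> coord c ` dom_of c. y $ 2 = 0}" and ch: "is_chart c"
    using assms(1) by (auto simp: straightens_def)
  show ?thesis
  proof
    assume "q \<in> K"
    then have "coord c q \<in> coord c ` (dom_of c \<inter> K)" using assms(2) by blast
    then show "coord c q $ 2 = 0" unfolding eq by blast
  next
    assume "coord c q $ 2 = 0"
    then have "coord c q \<in> coord c ` (dom_of c \<inter> K)" unfolding eq using assms(2) by blast
    then obtain q' where "q' \<in> dom_of c" "q' \<in> K" "coord c q = coord c q'" by blast
    then show "q \<in> K" using chart_inv_coord[OF ch] assms(2) by metis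
  qed
qed

lemma C1_curve_straightens:
  assumes "C1_curve A K" "p \<in> K"
  obtains c where "straightens c K" "p \<in> dom_of c"
  using assms unfolding C1_curve_def straightens_def by blast

lemma C1_curve_local_arc:
  assumes L: "C1_curve A L" "p \<in> L" and W: "open W" "p \<in> W"
  obtains V where "open V" "p \<in> V" "V \<subseteq> W" "path_connected (L \<inter> V)"
proof -
  obtain d where d: "straightens d L" "p \<in> dom_of d" using C1_curve_straightens[OF L] .
  then have ch: "is_chart d" by (simp add: straightens_def)
  define y0 where "y0 = coord d p"
  have "open (coord d ` (dom_of d \<inter> W))" by (rule open_coord_image[OF ch W(1)])
  moreover have "y0 \<in> coord d ` (dom_of d \<inter> W)" using d W by (simp add: y0_def)
  ultimately obtain r where r: "r > 0" "ball y0 r \<subseteq> coord d ` (dom_of d \<inter> W)"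
    using open_contains_ball by blast
  have rd: "ball y0 r \<subseteq> coord d ` dom_of d" using r by blast
  define V where "V = chart_inv d ` ball y0 r"
  show ?thesis
  proof
    show "open V" unfolding V_def by (rule open_chart_inv_image[OF ch open_ball rd])
    show "p \<in> V" unfolding V_def y0_def
      by (rule image_eqI[of _ _ "coord d p"]) (use chart_inv_coord[OF ch d(2)] r in auto)
    show "V \<subseteq> W" unfolding V_def using r(2) chart_inv_coord[OF ch] by force
    have "L \<inter> V = chart_inv d ` (ball y0 r \<inter> {y. y $ 2 = 0})"
    proof -
      have "chart_inv d y \<in> L \<longleftrightarrow> y $ 2 = 0" if "y \<in> ball y0 r" for y
        using straightens_iff[OF d(1) coord_chart_inv(2)[OF ch]] coord_chart_inv(1)[OF ch] that rd by auto
      then show ?thesis unfolding V_def by auto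
    qed
    moreover have "convex {y::real^2. y $ 2 = 0}"
      using convex_hyperplane[of "axis 2 1 :: real^2" 0] by (simp add: inner_axis')
    ultimately show "path_connected (L \<inter> V)"
      using rd by (auto intro!: path_connected_continuous_image convex_imp_path_connected convex_Int
          intro: continuous_on_subset[OF continuous_on_chart_inv[OF ch]])
  qed
qed

text \<open>Here \<open>y\<close> is a height function whose zero set near \<open>T\<close> is \<open>T\<close>. The last condition, that near each
  point of \<open>T\<close> the sign of the height decides the side, is what connects the components of the
  complement with the local position of another curve. A general height \<open>y\<close> allows the two
  sides to be interchanged by passing to \<open>- y\<close>.\<close>

definition sides :: "('a::metric_space \<Rightarrow> real) \<Rightarrow> 'a \<Rightarrow> real \<Rightarrow> 'a set \<Rightarrow> 'a set \<Rightarrow> 'a set \<Rightarrow> bool" where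
  "sides y p a T P N \<longleftrightarrow> P \<noteq> N \<and> components (ball p a - T) = {P, N} \<and> open P \<and> open N \<and>
     (\<forall>k\<in>T. \<exists>V. open V \<and> k \<in> V \<and> V \<subseteq> ball p a \<and>
        (\<forall>w\<in>V. (y w > 0 \<longrightarrow> w \<in> P) \<and> (y w < 0 \<longrightarrow> w \<in> N) \<and> (y w = 0 \<longrightarrow> w \<in> T)))"

lemma sides_flip: "sides y p a T P N \<Longrightarrow> sides (\<lambda>w. - y w) p a T N P"
  unfolding sides_def by (simp add: insert_commute) meson

definition crosses :: "('a::topological_space \<Rightarrow> real) \<Rightarrow> 'a set \<Rightarrow> 'a \<Rightarrow> bool" where
  "crosses y L p \<longleftrightarrow> (\<forall>W. open W \<and> p \<in> W \<longrightarrow> (\<exists>q\<in>L \<inter> W. y q > 0) \<and> (\<exists>q\<in>L \<inter> W. y q < 0))"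

text \<open>Near a point of \<open>T\<close> such a \<open>C\<close> lies in \<open>T \<union> P\<close>. So \<open>C - N\<close> and \<open>C \<inter> N\<close> are both open in \<open>C\<close>.\<close>

lemma one_sided_arc:
  assumes s: "sides y p a T P N" and C: "connected C" "C \<subseteq> ball p a"
    and y: "\<And>q. q \<in> C \<Longrightarrow> y q \<ge> 0"
  shows "C \<inter> P = {} \<or> C \<inter> N = {}"
proof (rule ccontr)
  assume ne: "\<not> ?thesis"
  have comp: "components (ball p a - T) = {P, N}" and PN: "P \<noteq> N" and op: "open P" "open N"
    using s by (auto simp: sides_def)
  have PN0: "P \<inter> N = {}" using components_nonoverlap[of P "ball p a - T" N] comp PN by auto
  have NT: "N \<inter> T = {}" using in_components_subset[of N "ball p a - T"] comp by auto
  have un: "ball p a - T = P \<union> N" using Union_components[of "ball p a - T"] comp by simp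
  define Vs where "Vs = {V. open V \<and> (\<forall>w\<in>V. (y w > 0 \<longrightarrow> w \<in> P) \<and> (y w < 0 \<longrightarrow> w \<in> N) \<and> (y w = 0 \<longrightarrow> w \<in> T))}"
  have T: "T \<subseteq> \<Union>Vs" using s unfolding sides_def Vs_def by blast
  have oVs: "open (\<Union>Vs)" by (rule open_Union) (auto simp: Vs_def)
  have dis: "w \<notin> N" if "w \<in> C" "w \<in> \<Union>Vs" for w
  proof -
    have "w \<in> P \<or> w \<in> T" using that y[OF that(1)] unfolding Vs_def by force
    then show ?thesis using PN0 NT by blast
  qed
  have "C \<subseteq> (P \<union> \<Union>Vs) \<union> N" using C(2) un T by blast
  moreover have "(P \<union> \<Union>Vs) \<inter> N \<inter> C = {}" using dis PN0 by blast
  moreover have "open (P \<union> \<Union>Vs)" using op oVs by blast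
  ultimately show False using C(1) op ne unfolding connected_def by blast
qed

text \<open>This transports \<open>axis_separation\<close> to the surface. The component of \<open>K\<close> in the ball becomes a
  component of the axis in a plane domain, and maximality of components provides the closedness
  and the local intervals needed there; boundedness provides a point of the axis outside.\<close>

lemma ball_sides:
  assumes c: "straightens c K" and p: "p \<in> K" and a: "a > 0" and sub: "ball p a \<subseteq> dom_of c"
    and con: "contractible (coord c ` ball p a)" and bd: "bounded (coord c ` ball p a)"
  obtains P N where "sides (\<lambda>q. coord c q $ 2) p a (connected_component_set (K \<inter> ball p a) p) P N"
proof -
  let ?u = "coord c" and ?v = "chart_inv c" and ?B = "ball p a"
  let ?T = "connected_component_set (K \<inter> ?B) p"
  have ch: "is_chart c" using c by (simp add: straightens_def)
  define D where "D = ?u ` ?B"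
  define T where "T = ?u ` ?T"
  have Dd: "D \<subseteq> ?u ` dom_of c" using sub by (auto simp: D_def)
  have vu: "?v (?u q) = q" if "q \<in> ?B" for q using chart_inv_coord[OF ch] sub that by blast
  have uv: "?u (?v y) = y" "?v y \<in> ?B" if "y \<in> D" for y
    using that vu by (auto simp: D_def)
  have cu: "continuous_on ?B ?u" by (rule continuous_on_subset[OF continuous_on_coord[OF ch] sub])
  have cv: "continuous_on D ?v" by (rule continuous_on_subset[OF continuous_on_chart_inv[OF ch] Dd])
  have hom: "homeomorphism ?B D ?u ?v"
    using vu uv cu cv by (auto simp: homeomorphism_def D_def image_image)
  have oD: "open D" using open_coord_image[OF ch open_ball[of p a]] sub by (simp add: D_def Int_absorb1)
  have conD: "contractible D" using con by (simp add: D_def)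
  have pT: "p \<in> ?T" using p a by simp
  have TB: "?T \<subseteq> ?B" "?T \<subseteq> K" using connected_component_subset[of "K \<inter> ?B" p] by auto
  have TD: "T \<subseteq> D" using TB by (auto simp: T_def D_def)
  have K_iff: "?v y \<in> K \<longleftrightarrow> y $ 2 = 0" if "y \<in> D" for y
    using straightens_iff[OF c, of "?v y"] uv[OF that] sub by auto
  have T0: "z $ 2 = 0" if "z \<in> T" for z
    using that TB straightens_iff[OF c] sub by (auto simp: T_def)
  have grow: "S \<subseteq> T" if S: "connected S" "S \<subseteq> D" "\<And>z. z \<in> S \<Longrightarrow> z $ 2 = 0" "z \<in> S" "z \<in> T" for S z
  proof -
    have z: "?v z \<in> ?T" using S(5) TB vu by (auto simp: T_def)
    have "?v ` S \<subseteq> connected_component_set (K \<inter> ?B) (?v z)"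
    proof (rule connected_component_maximal)
      show "connected (?v ` S)" using S(1,2) cv by (blast intro: connected_continuous_image continuous_on_subset)
      show "?v ` S \<subseteq> K \<inter> ?B" using S(2,3) K_iff uv by blast
    qed (use S(4) in blast)
    also have "\<dots> = ?T" using connected_component_eq[OF z] by simp
    finally have vS: "?v ` S \<subseteq> ?T" .
    show ?thesis
    proof
      fix s assume s: "s \<in> S"
      then have "?v s \<in> ?T" "?u (?v s) = s" using vS uv S(2) by blast+
      then show "s \<in> T" unfolding T_def by (metis image_eqI)
    qed
  qed
  obtain b where b: "\<And>y. y \<in> D \<Longrightarrow> norm y \<le> b" using bd by (auto simp: D_def bounded_iff)
  have "?u p \<in> D" using a by (simp add: D_def)
  then have b0: "b \<ge> 0" using b[of "?u p"] order_trans[OF norm_ge_zero] by blast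
  have cT: "connected T" unfolding T_def
    by (rule connected_continuous_image[OF continuous_on_subset[OF cu TB(1)]]) simp
  show ?thesis
  proof (rule axis_separation[of D T "?u p" "axis 1 (b + 1)"])
    show "open D" "contractible D" "connected T" "T \<subseteq> D" by fact+
    show "?u p \<in> T" using pT by (simp add: T_def)
    show "z $ 2 = 0" if "z \<in> T" for z using T0[OF that] .
    show "(axis 1 (b + 1) :: real^2) $ 2 = 0" by (simp add: axis_def)
    show "axis 1 (b + 1) \<notin> T"
    proof
      assume "axis 1 (b + 1) \<in> T"
      then have "norm (axis 1 (b + 1) :: real^2) \<le> b" using b TD by blast
      moreover have "b + 1 \<le> norm (axis 1 (b + 1) :: real^2)"
        using component_le_norm_cart[of "axis 1 (b + 1) :: real^2" 1] b0 by (simp add: axis_def)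
      ultimately show False by linarith
    qed
    show "z \<in> T" if z: "z \<in> D" "z \<in> closure T" for z
    proof -
      have "closure T \<subseteq> {w. w $ 2 = 0}"
        by (rule closure_minimal) (use T0 in \<open>auto intro!: closed_Collect_eq continuous_intros\<close>)
      then have z0: "z $ 2 = 0" using z by blast
      have "connected (insert z T)"
        by (rule connected_intermediate_closure[OF cT]) (use z closure_subset[of T] in blast)+
      moreover have "?u p \<in> T" using pT by (simp add: T_def)
      ultimately have "insert z T \<subseteq> T"
        using z z0 TD T0 by (intro grow[of _ "?u p"]) blast+
      then show ?thesis by blast
    qed
    show "\<exists>e>0. ball z e \<subseteq> D \<and> (\<forall>w\<in>ball z e. w $ 2 = 0 \<longrightarrow> w \<in> T)" if z: "z \<in> T" for z
    proof -
      obtain e where e: "e > 0" "ball z e \<subseteq> D" using oD z TD open_contains_ball by blast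
      have "convex {y::real^2. y $ 2 = 0}"
        using convex_hyperplane[of "axis 2 1 :: real^2" 0] by (simp add: inner_axis')
      then have "connected (ball z e \<inter> {y. y $ 2 = 0})" by (intro convex_connected convex_Int convex_ball)
      then have "ball z e \<inter> {y. y $ 2 = 0} \<subseteq> T"
        by (rule grow[of _ z]) (use e z T0 in auto)
      with e show ?thesis by blast
    qed
  next
    fix P N assume PN: "P \<noteq> N" "components (D - T) = {P, N}" "open P" "open N"
      and nbh: "\<And>z. z \<in> T \<Longrightarrow> \<exists>e>0. ball z e \<subseteq> D \<and>
       (\<forall>w\<in>ball z e. (w $ 2 > 0 \<longrightarrow> w \<in> P) \<and> (w $ 2 < 0 \<longrightarrow> w \<in> N) \<and> (w $ 2 = 0 \<longrightarrow> w \<in> T))"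
    have PND: "P \<subseteq> D" "N \<subseteq> D" using in_components_subset[of P "D - T"] in_components_subset[of N "D - T"] PN(2) by auto
    have img: "?v ` (D - T) = ?B - ?T"
    proof -
      have "?v ` D = ?B" using hom by (simp add: homeomorphism_def)
      moreover have "?v ` T = ?T" using vu TB(1) by (force simp: T_def image_image)
      moreover have "inj_on ?v D" using uv(1) by (rule inj_on_inverseI)
      ultimately show ?thesis using inj_on_image_set_diff[of ?v D D T] TD by auto
    qed
    have hom': "homeomorphism (D - T) (?B - ?T) ?v ?u"
      by (rule homeomorphism_of_subsets[OF homeomorphism_symD[OF hom] _ _ img]) auto
    have "sides (\<lambda>q. ?u q $ 2) p a ?T (?v ` P) (?v ` N)"
      unfolding sides_def
    proof (intro conjI ballI)
      show "?v ` P \<noteq> ?v ` N"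
      proof
        assume "?v ` P = ?v ` N"
        then have "?u ` ?v ` P = ?u ` ?v ` N" by simp
        moreover have "?u ` ?v ` S = S" if "S \<subseteq> D" for S using uv(1) that by (force simp: image_image)
        ultimately show False using PN(1) PND by simp
      qed
      show "components (?B - ?T) = {?v ` P, ?v ` N}"
        using homeomorphism_components[OF hom'] PN(2) by simp
      show "open (?v ` P)" "open (?v ` N)"
        using open_chart_inv_image[OF ch PN(3)] open_chart_inv_image[OF ch PN(4)] PND Dd by blast+
      fix k assume k: "k \<in> ?T"
      then obtain e where e: "e > 0" "ball (?u k) e \<subseteq> D"
        "\<And>w. w\<in>ball (?u k) e \<Longrightarrow> (w $ 2 > 0 \<longrightarrow> w \<in> P) \<and> (w $ 2 < 0 \<longrightarrow> w \<in> N) \<and> (w $ 2 = 0 \<longrightarrow> w \<in> T)"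
        using nbh[of "?u k"] by (auto simp: T_def)
      let ?V = "dom_of c \<inter> ?u -` ball (?u k) e"
      have V: "w \<in> ?B" "?v (?u w) = w" if "w \<in> ?V" for w
      proof -
        show "?v (?u w) = w" using chart_inv_coord[OF ch] that by blast
        moreover have "?u w \<in> D" using that e(2) by blast
        ultimately show "w \<in> ?B" using uv(2)[of "?u w"] by simp
      qed
      show "\<exists>V. open V \<and> k \<in> V \<and> V \<subseteq> ?B \<and> (\<forall>w\<in>V. (?u w $ 2 > 0 \<longrightarrow> w \<in> ?v ` P) \<and>
          (?u w $ 2 < 0 \<longrightarrow> w \<in> ?v ` N) \<and> (?u w $ 2 = 0 \<longrightarrow> w \<in> ?T))"
      proof (intro exI[of _ ?V] conjI ballI)
        show "open ?V" by (rule open_coord_vimage[OF ch open_ball])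
        show "k \<in> ?V" using k TB(1) sub e(1) by auto
        show "?V \<subseteq> ?B" using V(1) by blast
        fix w assume w: "w \<in> ?V"
        have "?u w \<in> ball (?u k) e" using w by blast
        note ew = e(3)[OF this]
        have "?u w \<in> S \<Longrightarrow> w \<in> ?v ` S" for S using V(2)[OF w] by (intro image_eqI[of _ _ "?u w"]) simp_all
        then show "?u w $ 2 > 0 \<longrightarrow> w \<in> ?v ` P" "?u w $ 2 < 0 \<longrightarrow> w \<in> ?v ` N"
          using ew by blast+
        show "?u w $ 2 = 0 \<longrightarrow> w \<in> ?T"
        proof
          assume "?u w $ 2 = 0"
          then have "?u w \<in> T" using ew by blast
          then obtain t where "t \<in> ?T" "?u w = ?u t" by (auto simp: T_def)
          moreover from this have "?v (?u t) = t" using vu TB(1) by blast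
          ultimately show "w \<in> ?T" using V(2)[OF w] by simp
        qed
      qed
    qed
    then show thesis by (rule that)
  qed
qed

section \<open>Sakai transversality means crossing\<close>

text \<open>Two different charts are involved: the ball is star-shaped in a smooth chart of the atlas,
  while \<open>K\<close> is straight only in a \<open>C\<^sup>1\<close> chart. Contractibility is topological, so it passes from one
  to the other.\<close>

lemma small_ball_sides:
  fixes A :: "'a::metric_space chart set" and p :: 'a
  assumes A: "smooth_atlas A" and g: "riemannian_metric A g" and d: "riemannian_distance A g"
    and c: "straightens c K" and p: "p \<in> K" "p \<in> dom_of c"
  shows "\<exists>a0>0. \<forall>a. 0 < a \<and> a < a0 \<longrightarrow>
    (\<exists>P N. sides (\<lambda>q. coord c q $ 2) p a (connected_component_set (K \<inter> ball p a) p) P N)"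
proof -
  have ch: "is_chart c" using c by (simp add: straightens_def)
  obtain b where b: "b \<in> A" "p \<in> dom_of b" using atlas_cover[OF A] by blast
  have chb: "is_chart b" by (rule atlas_chart[OF A b(1)])
  obtain a1 where a1: "a1 > 0" "\<And>a. 0 < a \<Longrightarrow> a < a1 \<Longrightarrow> ball p a \<subseteq> dom_of b \<and> starlike (coord b ` ball p a)"
    using small_ball_starlike[OF A g d b] by blast
  have "open (dom_of c \<inter> coord c -` ball (coord c p) 1)" by (rule open_coord_vimage[OF ch open_ball])
  moreover have "p \<in> dom_of c \<inter> coord c -` ball (coord c p) 1" using p by simp
  ultimately obtain a2 where a2: "a2 > 0" "ball p a2 \<subseteq> dom_of c \<inter> coord c -` ball (coord c p) 1"
    using open_contains_ball by blast
  have "\<exists>P N. sides (\<lambda>q. coord c q $ 2) p a (connected_component_set (K \<inter> ball p a) p) P N"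
    if a: "0 < a" "a < min a1 a2" for a
  proof -
    have "ball p a \<subseteq> ball p a2" using a by auto
    then have sub: "ball p a \<subseteq> dom_of c" and bd: "coord c ` ball p a \<subseteq> ball (coord c p) 1"
      using a2(2) by blast+
    have subb: "ball p a \<subseteq> dom_of b" and star: "starlike (coord b ` ball p a)"
      using a1(2)[of a] a by auto
    have hom: "coord d ` ball p a homeomorphic ball p a" if "is_chart d" "ball p a \<subseteq> dom_of d" for d
      using homeomorphism_of_subsets[OF chart_homeomorphism[OF that(1)] that(2) subset_refl refl]
      unfolding homeomorphic_def by (meson homeomorphism_symD)
    have "coord b ` ball p a homeomorphic coord c ` ball p a"
      using hom[OF chb subb] hom[OF ch sub] by (meson homeomorphic_sym homeomorphic_trans)
    then have "contractible (coord c ` ball p a)"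
      using homeomorphic_contractible[OF starlike_imp_contractible[OF star]] by blast
    then show ?thesis
      using ball_sides[OF c p(1) a(1) sub _ bounded_subset[OF bounded_ball bd]] by blast
  qed
  then show ?thesis using a1(1) a2(1) by (intro exI[of _ "min a1 a2"]) auto
qed

lemma sakai_transverse_iff_crosses:
  fixes p :: "'a::metric_space"
  assumes sd: "\<exists>a0>0. \<forall>a. 0 < a \<and> a < a0 \<longrightarrow>
      (\<exists>P N. sides y p a (connected_component_set (K \<inter> ball p a) p) P N)"
    and L: "C1_curve A L" "p \<in> L" and K: "p \<in> K"
  shows "sakai_transverse K L p \<longleftrightarrow> crosses y L p"
proof
  obtain a0 where a0: "a0 > 0" "\<And>a. 0 < a \<Longrightarrow> a < a0 \<Longrightarrow>
      \<exists>P N. sides y p a (connected_component_set (K \<inter> ball p a) p) P N"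
    using sd by blast
  show "crosses y L p" if S: "sakai_transverse K L p"
  proof (rule ccontr)
    assume "\<not> crosses y L p"
    then obtain W where W: "open W" "p \<in> W" and "\<not> ((\<exists>q\<in>L \<inter> W. y q > 0) \<and> (\<exists>q\<in>L \<inter> W. y q < 0))"
      unfolding crosses_def by blast
    then have one: "(\<forall>q\<in>L \<inter> W. - y q \<ge> 0) \<or> (\<forall>q\<in>L \<inter> W. y q \<ge> 0)" by (auto simp: not_less)
    obtain r where r: "r > 0" "ball p r \<subseteq> W" using W open_contains_ball by blast
    obtain a1 where a1: "a1 > 0" "\<forall>a. 0 < a \<and> a < a1 \<longrightarrow>
        (\<exists>P N. P \<noteq> N \<and> components (ball p a - connected_component_set (K \<inter> ball p a) p) = {P, N} \<and> open P \<and> open N \<and>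
          connected_component_set (L \<inter> ball p a) p \<inter> P \<noteq> {} \<and> connected_component_set (L \<inter> ball p a) p \<inter> N \<noteq> {})"
      using S unfolding sakai_transverse_def Let_def by (elim exE conjE)
    define a where "a = min r (min a0 a1) / 2"
    have a: "0 < a" "a < r" "a < a0" "a < a1" using r a0 a1 by (auto simp: a_def min_def)
    let ?T = "connected_component_set (K \<inter> ball p a) p" and ?C = "connected_component_set (L \<inter> ball p a) p"
    obtain P N where s: "sides y p a ?T P N" using a0(2) a by blast
    have meets: "?C \<inter> P \<noteq> {} \<and> ?C \<inter> N \<noteq> {}"
    proof -
      obtain P' N' where "components (ball p a - ?T) = {P', N'}" "?C \<inter> P' \<noteq> {}" "?C \<inter> N' \<noteq> {}"
        using a1(2)[rule_format, OF conjI[OF a(1,4)]] by (elim exE conjE)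
      moreover have "components (ball p a - ?T) = {P, N}" using s by (simp add: sides_def)
      ultimately have "{P', N'} = {P, N}" by simp
      then have "(P' = P \<and> N' = N) \<or> (P' = N \<and> N' = P)" by (simp only: doubleton_eq_iff)
      then show ?thesis using \<open>?C \<inter> P' \<noteq> {}\<close> \<open>?C \<inter> N' \<noteq> {}\<close> by blast
    qed
    have C: "connected ?C" "?C \<subseteq> ball p a" using connected_component_subset[of "L \<inter> ball p a" p] by auto
    have "ball p a \<subseteq> ball p r" using a(2) by auto
    then have "?C \<subseteq> L \<inter> W"
      using connected_component_subset[of "L \<inter> ball p a" p] r(2) by blast
    then have "(\<forall>q\<in>?C. - y q \<ge> 0) \<or> (\<forall>q\<in>?C. y q \<ge> 0)" using one by blast
    then show False
      using one_sided_arc[OF s C] one_sided_arc[OF sides_flip[OF s] C] meets by blast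
  qed
  show "sakai_transverse K L p" if cr: "crosses y L p"
    unfolding sakai_transverse_def Let_def
  proof (intro exI[of _ a0] conjI allI impI)
    show "a0 > 0" by (rule a0)
    fix a assume a: "0 < a \<and> a < a0"
    let ?T = "connected_component_set (K \<inter> ball p a) p" and ?C = "connected_component_set (L \<inter> ball p a) p"
    obtain P N where s: "sides y p a ?T P N" using a0(2) a by blast
    have "p \<in> ?T" using K a by simp
    then obtain V where V: "open V" "p \<in> V" "V \<subseteq> ball p a"
      "\<And>w. w \<in> V \<Longrightarrow> (y w > 0 \<longrightarrow> w \<in> P) \<and> (y w < 0 \<longrightarrow> w \<in> N)"
      using s unfolding sides_def by blast
    obtain V' where V': "open V'" "p \<in> V'" "V' \<subseteq> V" "path_connected (L \<inter> V')"
      using C1_curve_local_arc[OF L V(1,2)] .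
    have "L \<inter> V' \<subseteq> ?C"
      by (rule connected_component_maximal) (use L V V' path_connected_imp_connected in auto)
    moreover obtain q1 q2 where "q1 \<in> L \<inter> V'" "y q1 > 0" "q2 \<in> L \<inter> V'" "y q2 < 0"
      using cr V'(1,2) unfolding crosses_def by blast
    ultimately have "?C \<inter> P \<noteq> {} \<and> ?C \<inter> N \<noteq> {}" using V(4) V'(3) by blast
    then show "\<exists>P N. P \<noteq> N \<and> components (ball p a - ?T) = {P, N} \<and> open P \<and> open N \<and> ?C \<inter> P \<noteq> {} \<and> ?C \<inter> N \<noteq> {}"
      using s unfolding sides_def by blast
  qed
qed

section \<open>Essential intersections mean crossing\<close>

lemma C0_dist_leD:
  assumes "C0_dist X f h \<le> ennreal \<delta>" "x \<in> topspace X" "\<delta> \<ge> 0"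
  shows "dist (f x) (h x) \<le> \<delta>"
proof -
  have "ennreal (dist (f x) (h x)) \<le> C0_dist X f h"
    unfolding C0_dist_def by (rule SUP_upper[OF assms(2)])
  also have "\<dots> \<le> ennreal \<delta>" by (rule assms(1))
  finally show ?thesis using assms(3) by simp
qed

lemma C0_dist_leI:
  assumes "\<And>x. x \<in> topspace X \<Longrightarrow> dist (f x) (h x) \<le> \<delta>"
  shows "C0_dist X f h \<le> ennreal \<delta>"
  unfolding C0_dist_def by (rule SUP_least) (simp add: assms ennreal_leI)

text \<open>The perturbation of \<open>L\<close> pushes by \<open>\<epsilon> (r - \<bar>y - y0\<bar>)\<close> in the direction of the sign \<open>\<sigma>\<close> inside
  a coordinate disc of radius \<open>r\<close>. With \<open>\<epsilon> \<le> 1\<close> it maps the disc to itself, and it is the identity on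
  the boundary circle, so it extends by the identity to a continuous map of the whole surface.\<close>

lemma not_transverse_if_one_sided:
  fixes p :: "'a::metric_space"
  assumes c: "straightens c K" and p: "p \<in> K" "p \<in> L" "p \<in> dom_of c"
    and W: "open W" "p \<in> W" and \<sigma>: "\<bar>\<sigma>\<bar> = 1" and one: "\<And>q. q \<in> L \<inter> W \<Longrightarrow> \<sigma> * coord c q $ 2 \<ge> 0"
  shows "\<not> C0_transverse_subsets K L p"
proof
  assume tr: "C0_transverse_subsets K L p"
  let ?u = "coord c" and ?v = "chart_inv c"
  have ch: "is_chart c" using c by (simp add: straightens_def)
  define y0 where "y0 = ?u p"
  have "open (?u ` (dom_of c \<inter> W))" by (rule open_coord_image[OF ch W(1)])
  moreover have "y0 \<in> ?u ` (dom_of c \<inter> W)" using p W by (simp add: y0_def)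
  ultimately obtain r where r: "r > 0" "cball y0 r \<subseteq> ?u ` (dom_of c \<inter> W)"
    unfolding open_contains_cball by blast
  have rd: "cball y0 r \<subseteq> ?u ` dom_of c" "ball y0 r \<subseteq> ?u ` dom_of c" using r(2) ball_subset_cball by blast+
  have uv: "?u (?v y) = y" "?v y \<in> dom_of c" if "y \<in> cball y0 r" for y
    using coord_chart_inv[OF ch] rd that by blast+
  have vW: "?v y \<in> W" if y: "y \<in> cball y0 r" for y
  proof -
    obtain q where "q \<in> dom_of c \<inter> W" "y = ?u q" using r(2) y by blast
    then show ?thesis using chart_inv_coord[OF ch] by simp
  qed
  define B where "B = ?v ` ball y0 r"
  have oB: "open B" unfolding B_def by (rule open_chart_inv_image[OF ch open_ball rd(2)])
  have pB: "p \<in> B" unfolding B_def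
    by (rule image_eqI[of _ _ y0]) (use chart_inv_coord[OF ch p(3)] r in \<open>auto simp: y0_def\<close>)
  have "openin (top_of_set K) (K \<inter> B)" "openin (top_of_set L) (L \<inter> B)"
    using oB by (auto simp: openin_open)
  then have "openin (top_of_set K) (K \<inter> B) \<and> openin (top_of_set L) (L \<inter> B) \<and> p \<in> K \<inter> B \<and> p \<in> L \<inter> B"
    using p pB by simp
  moreover have "\<forall>U V. openin (top_of_set K) U \<and> openin (top_of_set L) V \<and> p \<in> U \<and> p \<in> V \<longrightarrow>
      (\<exists>\<delta>>0. essential_intersection (top_of_set K) (top_of_set L) (\<lambda>x. x) (\<lambda>x. x) U V \<delta>)"
    using tr unfolding C0_transverse_subsets_def C0_transverse_at_pair_def by (elim conjE)
  ultimately have "\<exists>\<delta>>0. essential_intersection (top_of_set K) (top_of_set L) (\<lambda>x. x) (\<lambda>x. x) (K \<inter> B) (L \<inter> B) \<delta>"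
    by simp
  then obtain \<delta> where \<delta>: "\<delta> > 0"
    "essential_intersection (top_of_set K) (top_of_set L) (\<lambda>x. x) (\<lambda>x. x) (K \<inter> B) (L \<inter> B) \<delta>"
    by (elim exE conjE)
  have cv: "continuous_on (cball y0 r) ?v" by (rule continuous_on_subset[OF continuous_on_chart_inv[OF ch] rd(1)])
  obtain \<eta> where \<eta>: "\<eta> > 0" "\<And>y z. y \<in> cball y0 r \<Longrightarrow> z \<in> cball y0 r \<Longrightarrow> dist z y < \<eta> \<Longrightarrow> dist (?v z) (?v y) < \<delta>"
    using compact_uniformly_continuous[OF cv compact_cball, unfolded uniformly_continuous_on_def, rule_format, OF \<delta>(1)]
    by blast
  define \<epsilon> where "\<epsilon> = min 1 (\<eta> / (2 * r))"
  have \<epsilon>: "0 < \<epsilon>" "\<epsilon> \<le> 1" "\<epsilon> * r < \<eta>"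
  proof -
    show "0 < \<epsilon>" "\<epsilon> \<le> 1" using \<eta>(1) r(1) by (auto simp: \<epsilon>_def)
    have "\<epsilon> * r \<le> (\<eta> / (2 * r)) * r" using r(1) by (intro mult_right_mono) (auto simp: \<epsilon>_def)
    also have "\<dots> = \<eta> / 2" using r(1) by simp
    finally show "\<epsilon> * r < \<eta>" using \<eta>(1) by simp
  qed
  define \<Phi> where "\<Phi> y = y + (\<sigma> * (\<epsilon> * (r - dist y0 y))) *\<^sub>R axis 2 1" for y :: "real^2"
  have move: "dist y (\<Phi> y) = \<epsilon> * (r - dist y0 y)" if "y \<in> cball y0 r" for y
  proof -
    have "dist y (\<Phi> y) = \<bar>\<sigma> * (\<epsilon> * (r - dist y0 y))\<bar>" by (simp add: \<Phi>_def dist_norm norm_axis_1)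
    also have "\<dots> = \<bar>\<epsilon> * (r - dist y0 y)\<bar>" by (simp add: abs_mult \<sigma>)
    finally show ?thesis using that \<epsilon>(1) by simp
  qed
  have \<Phi>_cball: "\<Phi> y \<in> cball y0 r" if y: "y \<in> cball y0 r" for y
  proof -
    have "dist y0 (\<Phi> y) \<le> dist y0 y + \<epsilon> * (r - dist y0 y)"
      using dist_triangle[of y0 "\<Phi> y" y] move[OF y] by simp
    also have "\<dots> \<le> dist y0 y + 1 * (r - dist y0 y)"
      using y \<epsilon>(2) by (intro add_left_mono mult_right_mono) auto
    finally show ?thesis by simp
  qed
  have \<Phi>_close: "dist (?v (\<Phi> y)) (?v y) < \<delta>" if y: "y \<in> cball y0 r" for y
  proof (rule \<eta>(2)[OF y \<Phi>_cball[OF y]])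
    have "dist y (\<Phi> y) \<le> \<epsilon> * r" unfolding move[OF y] using \<epsilon>(1) by (intro mult_left_mono) auto
    then show "dist (\<Phi> y) y < \<eta>" using \<epsilon>(3) by (simp add: dist_commute)
  qed
  let ?C = "?v ` cball y0 r"
  define k where "k q = (if q \<in> ?C then ?v (\<Phi> (?u q)) else q)" for q
  have kv: "k (?v y) = ?v (\<Phi> y)" if "y \<in> cball y0 r" for y
    using that uv(1)[OF that] by (simp add: k_def)
  have "continuous_on (?C \<union> - B) k"
    unfolding k_def
  proof (rule continuous_on_cases)
    have "compact ?C" by (rule compact_continuous_image[OF cv compact_cball])
    then show "closed ?C" by (rule compact_imp_closed)
    show "closed (- B)" using oB by (simp add: closed_Compl)
    have c\<Phi>: "continuous_on S \<Phi>" for S unfolding \<Phi>_def by (intro continuous_intros)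
    have cu: "continuous_on ?C ?u"
      using uv(2) by (intro continuous_on_subset[OF continuous_on_coord[OF ch]]) auto
    show "continuous_on ?C (\<lambda>q. ?v (\<Phi> (?u q)))"
      by (rule continuous_on_compose2[OF cv continuous_on_compose2[OF c\<Phi>[of UNIV] cu]]) (use uv(1) \<Phi>_cball in auto)
    show "continuous_on (- B) (\<lambda>q. q)" by simp
    show "\<forall>q. (q \<in> ?C \<and> \<not> q \<in> ?C) \<or> (q \<in> - B \<and> q \<in> ?C) \<longrightarrow> ?v (\<Phi> (?u q)) = q"
    proof (intro allI impI)
      fix q assume "(q \<in> ?C \<and> \<not> q \<in> ?C) \<or> (q \<in> - B \<and> q \<in> ?C)"
      then obtain y where y: "y \<in> cball y0 r" "q = ?v y" "q \<notin> B" by blast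
      then have "y \<notin> ball y0 r" by (auto simp: B_def)
      then have "dist y0 y = r" using y(1) by simp
      then have "\<Phi> y = y" by (simp add: \<Phi>_def)
      then show "?v (\<Phi> (?u q)) = q" using y uv(1) by simp
    qed
  qed
  moreover have "?C \<union> - B = UNIV" using ball_subset_cball by (auto simp: B_def)
  ultimately have "continuous_on L k" using continuous_on_subset[of UNIV k L] by simp
  then have "continuous_map (top_of_set L) euclidean k" by simp
  moreover have "continuous_map (top_of_set K) euclidean (\<lambda>x. x)" by simp
  moreover have "C0_dist (top_of_set K) (\<lambda>x. x) (\<lambda>x. x) \<le> ennreal \<delta>"
    by (rule C0_dist_leI) (use \<delta>(1) in simp)
  moreover have "C0_dist (top_of_set L) (\<lambda>x. x) k \<le> ennreal \<delta>"
  proof (rule C0_dist_leI)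
    fix q
    show "dist q (k q) \<le> \<delta>"
    proof (cases "q \<in> ?C")
      case True
      then obtain y where y: "y \<in> cball y0 r" "q = ?v y" by blast
      then show ?thesis using \<Phi>_close[OF y(1)] kv[OF y(1)] by (simp add: dist_commute)
    next
      case False
      then show ?thesis using \<delta>(1) by (simp add: k_def)
    qed
  qed
  ultimately have "(\<lambda>x. x) ` (K \<inter> B) \<inter> k ` (L \<inter> B) \<noteq> {}"
    using \<delta>(2) unfolding essential_intersection_def by blast
  then obtain q where q: "q \<in> L" "q \<in> B" "k q \<in> K" by blast
  then obtain y where y: "y \<in> ball y0 r" "q = ?v y" by (auto simp: B_def)
  then have yc: "y \<in> cball y0 r" by simp
  have "\<sigma> * y $ 2 \<ge> 0" using one[of q] q(1) vW[OF yc] y(2) uv(1)[OF yc] by simp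
  moreover have "\<sigma> * \<Phi> y $ 2 = \<sigma> * y $ 2 + \<epsilon> * (r - dist y0 y)"
  proof -
    have "\<sigma> * \<sigma> = 1" using \<sigma> by (metis abs_mult_self_eq mult_1)
    then show ?thesis by (simp add: \<Phi>_def distrib_left mult.assoc[symmetric])
  qed
  moreover have "\<epsilon> * (r - dist y0 y) > 0" using \<epsilon>(1) y(1) by simp
  ultimately have "\<Phi> y $ 2 \<noteq> 0" by auto
  then have "?v (\<Phi> y) \<notin> K"
    using straightens_iff[OF c uv(2)[OF \<Phi>_cball[OF yc]]] uv(1)[OF \<Phi>_cball[OF yc]] by simp
  then show False using q(3) kv[OF yc] y(2) by simp
qed

text \<open>Clamping the first coordinate of \<open>F\<close> and the second one of \<open>G\<close> to the rectangle of half-widths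
  \<open>\<rho>\<close> and \<open>\<eta>\<close> gives paths between its opposite sides, to which the Fashoda meet theorem applies. The
  strict bounds on the other coordinates ensure that neither path is clamped at the meeting point.\<close>

lemma crossing_paths_meet:
  fixes F G :: "real \<Rightarrow> real^2"
  assumes F: "continuous_on {0..1} F" and G: "continuous_on {0..1} G" and pos: "\<rho> > 0" "\<eta> > 0"
    and F1: "F 0 $ 1 \<le> x - \<rho>" "F 1 $ 1 \<ge> x + \<rho>" and F2: "\<And>t. t \<in> {0..1} \<Longrightarrow> \<bar>F t $ 2\<bar> < \<eta>"
    and G2: "G 0 $ 2 \<le> - \<eta>" "G 1 $ 2 \<ge> \<eta>" and G1: "\<And>t. t \<in> {0..1} \<Longrightarrow> \<bar>G t $ 1 - x\<bar> < \<rho>"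
  shows "\<exists>s\<in>{0..1}. \<exists>t\<in>{0..1}. F s = G t"
proof -
  define F' where "F' t = max (x - \<rho>) (min (x + \<rho>) (F t $ 1)) *\<^sub>R axis 1 1 + (F t $ 2) *\<^sub>R (axis 2 1 :: real^2)" for t
  define G' where "G' t = (G t $ 1) *\<^sub>R axis 1 1 + max (- \<eta>) (min \<eta> (G t $ 2)) *\<^sub>R (axis 2 1 :: real^2)" for t
  define lo where "lo = (x - \<rho>) *\<^sub>R axis 1 1 + (- \<eta>) *\<^sub>R (axis 2 1 :: real^2)"
  define hi where "hi = (x + \<rho>) *\<^sub>R axis 1 1 + \<eta> *\<^sub>R (axis 2 1 :: real^2)"
  have F': "F' t $ 1 = max (x - \<rho>) (min (x + \<rho>) (F t $ 1))" "F' t $ 2 = F t $ 2" for t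
    by (simp_all add: F'_def axis_def)
  have G': "G' t $ 1 = G t $ 1" "G' t $ 2 = max (- \<eta>) (min \<eta> (G t $ 2))" for t
    by (simp_all add: G'_def axis_def)
  have lohi: "lo $ 1 = x - \<rho>" "lo $ 2 = - \<eta>" "hi $ 1 = x + \<rho>" "hi $ 2 = \<eta>"
    by (simp_all add: lo_def hi_def axis_def)
  obtain z where z: "z \<in> path_image F'" "z \<in> path_image G'"
  proof (rule fashoda[of F' G' lo hi])
    show "path F'" unfolding path_def F'_def by (intro continuous_intros F)
    show "path G'" unfolding path_def G'_def by (intro continuous_intros G)
    have "F' t \<in> cbox lo hi" if "t \<in> {0..1}" for t
      using F2[OF that, unfolded abs_less_iff] pos by (simp add: mem_box_cart forall_2 F' lohi)
    then show "path_image F' \<subseteq> cbox lo hi" by (auto simp: path_image_def)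
    have "G' t \<in> cbox lo hi" if "t \<in> {0..1}" for t
      using G1[OF that, unfolded abs_less_iff] pos by (simp add: mem_box_cart forall_2 G' lohi)
    then show "path_image G' \<subseteq> cbox lo hi" by (auto simp: path_image_def)
    show "pathstart F' $ 1 = lo $ 1" "pathfinish F' $ 1 = hi $ 1" "pathstart G' $ 2 = lo $ 2" "pathfinish G' $ 2 = hi $ 2"
      using F1 G2 pos by (simp_all add: pathstart_def pathfinish_def F' G' lohi)
  qed blast
  then obtain s t where st: "s \<in> {0..1}" "t \<in> {0..1}" "F' s = G' t" by (auto simp: path_image_def)
  have "F' s $ 1 = G' t $ 1" "F' s $ 2 = G' t $ 2" using st(3) by simp_all
  then have "F s $ 1 = G t $ 1" "F s $ 2 = G t $ 2"
    using F2[OF st(1)] G1[OF st(2)] unfolding F' G' by linarith+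
  then have "F s = G t" by (simp add: vec_eq_iff forall_2)
  with st show ?thesis by blast
qed

lemma uniform_near_compact:
  fixes f :: "'a::metric_space \<Rightarrow> 'b::metric_space"
  assumes C: "compact C" "C \<subseteq> S" and S: "open S" and f: "continuous_on S f" and \<eta>: "\<eta> > 0"
  obtains \<delta> where "\<delta> > 0" "\<And>q q'. q \<in> C \<Longrightarrow> dist q q' \<le> \<delta> \<Longrightarrow> q' \<in> S \<and> dist (f q) (f q') < \<eta>"
proof -
  define \<G> where "\<G> = {B. open B \<and> B \<subseteq> S \<and> (\<forall>a\<in>B. \<forall>b\<in>B. dist (f a) (f b) < \<eta>)}"
  have "C \<subseteq> \<Union>\<G>"
  proof
    fix q assume q: "q \<in> C"
    let ?B = "S \<inter> f -` ball (f q) (\<eta> / 2)"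
    have "open ?B" by (rule continuous_open_preimage[OF f S open_ball])
    moreover have "dist (f a) (f b) < \<eta>" if "a \<in> ?B" "b \<in> ?B" for a b
      using that dist_triangle_half_r[of "f q" "f a" \<eta> "f b"] by simp
    ultimately have "?B \<in> \<G>" by (simp add: \<G>_def)
    moreover have "q \<in> ?B" using q C \<eta> by auto
    ultimately show "q \<in> \<Union>\<G>" by blast
  qed
  then obtain e where e: "e > 0" "\<And>q. q \<in> C \<Longrightarrow> \<exists>B\<in>\<G>. ball q e \<subseteq> B"
    using Heine_Borel_lemma[OF C(1), of \<G>] unfolding \<G>_def by blast
  show ?thesis
  proof (rule that[of "e / 2"])
    show "e / 2 > 0" using e by simp
    fix q q' assume q: "q \<in> C" "dist q q' \<le> e / 2"
    obtain B where "B \<in> \<G>" "ball q e \<subseteq> B" using e(2)[OF q(1)] by blast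
    moreover have "q \<in> ball q e" "q' \<in> ball q e" using q(2) e(1) by auto
    ultimately show "q' \<in> S \<and> dist (f q) (f q') < \<eta>" unfolding \<G>_def by blast
  qed
qed

text \<open>All constants live in coordinates around \<open>y0\<close>: the segment of \<open>K\<close> has half-length \<open>R / 2\<close>,
  the arc of \<open>L\<close> stays within \<open>R / 8\<close> of \<open>y0\<close> and its end points have heights of absolute value at
  least \<open>2 * \<eta>\<close>. A perturbation by less than \<open>\<eta> \<le> R / 8\<close> leaves the hypotheses of
  \<open>crossing_paths_meet\<close> true with \<open>\<rho> = R / 4\<close>.\<close>

lemma transverse_if_crosses:
  fixes p :: "'a::metric_space"
  assumes c: "straightens c K" and p: "p \<in> K" "p \<in> L" "p \<in> dom_of c" and L: "C1_curve A L"
    and cr: "crosses (\<lambda>q. coord c q $ 2) L p"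
  shows "C0_transverse_subsets K L p"
  unfolding C0_transverse_subsets_def C0_transverse_at_pair_def
proof (intro conjI allI impI)
  show "p \<in> topspace (top_of_set K)" "p \<in> topspace (top_of_set L)" "p = p" using p by auto
  fix U V assume UV: "openin (top_of_set K) U \<and> openin (top_of_set L) V \<and> p \<in> U \<and> p \<in> V"
  obtain U0 where U0: "open U0" "U = K \<inter> U0" "p \<in> U0" using UV by (auto simp: openin_open)
  obtain V0 where V0: "open V0" "V = L \<inter> V0" "p \<in> V0" using UV by (auto simp: openin_open)
  let ?u = "coord c" and ?v = "chart_inv c"
  have ch: "is_chart c" using c by (simp add: straightens_def)
  define y0 where "y0 = ?u p"
  have y02: "y0 $ 2 = 0" using straightens_iff[OF c p(3)] p(1) by (simp add: y0_def)
  let ?W = "dom_of c \<inter> (U0 \<inter> V0)"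
  have "open (?u ` ?W)" by (rule open_coord_image[OF ch open_Int[OF U0(1) V0(1)]])
  moreover have "y0 \<in> ?u ` ?W" using p U0 V0 by (simp add: y0_def)
  ultimately obtain R where R: "R > 0" "cball y0 R \<subseteq> ?u ` ?W"
    unfolding open_contains_cball by blast
  have v: "?u (?v y) = y" "?v y \<in> dom_of c" "?v y \<in> U0" "?v y \<in> V0" if y: "y \<in> cball y0 R" for y
  proof -
    obtain q where "q \<in> ?W" "y = ?u q" using R(2) y by blast
    then show "?u (?v y) = y" "?v y \<in> dom_of c" "?v y \<in> U0" "?v y \<in> V0" using chart_inv_coord[OF ch] by auto
  qed
  have cv: "continuous_on (cball y0 R) ?v"
    by (rule continuous_on_subset[OF continuous_on_chart_inv[OF ch]]) (use R(2) in blast)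
  define C where "C = ?v ` cball y0 R"
  have C: "compact C" "C \<subseteq> dom_of c"
    using compact_continuous_image[OF cv compact_cball] v(2) by (auto simp: C_def)

  have "open (dom_of c \<inter> ?u -` ball y0 (R / 8))" by (rule open_coord_vimage[OF ch open_ball])
  moreover have "p \<in> dom_of c \<inter> ?u -` ball y0 (R / 8)" using p(3) R(1) by (simp add: y0_def)
  ultimately obtain J where J: "open J" "p \<in> J" "J \<subseteq> dom_of c \<inter> ?u -` ball y0 (R / 8)" "path_connected (L \<inter> J)"
    by (rule C1_curve_local_arc[OF L p(2)])
  obtain q1 q2 where q: "q1 \<in> L \<inter> J" "?u q1 $ 2 > 0" "q2 \<in> L \<inter> J" "?u q2 $ 2 < 0"
    using cr J(1,2) unfolding crosses_def by blast
  obtain l where l: "path l" "path_image l \<subseteq> L \<inter> J" "pathstart l = q2" "pathfinish l = q1"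
    using J(4) q unfolding path_connected_def by blast
  have lt: "l t \<in> L" "l t \<in> dom_of c" "dist y0 (?u (l t)) < R / 8" "l t \<in> C" "l t \<in> V0" if "t \<in> {0..1}" for t
  proof -
    have "l t \<in> L \<inter> J" using l(2) that by (auto simp: path_image_def)
    then show 1: "l t \<in> L" "l t \<in> dom_of c" "dist y0 (?u (l t)) < R / 8" using J(3) by auto
    then have 2: "?u (l t) \<in> cball y0 R" using R(1) by auto
    have 3: "?v (?u (l t)) = l t" by (rule chart_inv_coord[OF ch 1(2)])
    show "l t \<in> C" unfolding C_def using imageI[OF 2, of ?v] 3 by simp
    show "l t \<in> V0" using v(4)[OF 2] 3 by simp
  qed
  define m where "m t = y0 + ((2 * t - 1) * (R / 2)) *\<^sub>R axis 1 1" for t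
  have m: "m t \<in> cball y0 R" if "t \<in> {0..1}" for t
  proof -
    have "\<bar>2 * t - 1\<bar> * (R / 2) \<le> 1 * R" using that R(1) by (intro mult_mono) auto
    then show ?thesis using R(1) by (simp add: m_def dist_norm norm_axis_1 abs_mult)
  qed
  have m12: "m t $ 1 = y0 $ 1 + (2 * t - 1) * (R / 2)" "m t $ 2 = 0" for t
    using y02 by (simp_all add: m_def axis_def)
  have mK: "?v (m t) \<in> K" "?v (m t) \<in> U0" "?v (m t) \<in> C" if "t \<in> {0..1}" for t
    using straightens_iff[OF c v(2)[OF m[OF that]]] v[OF m[OF that]] m12 m[OF that] by (auto simp: C_def)
  define \<eta> where "\<eta> = min (R / 8) (min (?u q1 $ 2) (- (?u q2 $ 2)) / 2)"
  have \<eta>: "\<eta> > 0" "\<eta> \<le> R / 8" "2 * \<eta> \<le> ?u q1 $ 2" "2 * \<eta> \<le> - (?u q2 $ 2)"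
    using R(1) q unfolding \<eta>_def by auto
  have "open (dom_of c)" using ch by (simp add: is_chart_def)
  then obtain \<delta> where \<delta>: "\<delta> > 0" "\<And>q q'. q \<in> C \<Longrightarrow> dist q q' \<le> \<delta> \<Longrightarrow> q' \<in> dom_of c \<and> dist (?u q) (?u q') < \<eta>"
    using uniform_near_compact[OF C _ continuous_on_coord[OF ch] \<eta>(1)] by blast
  have "essential_intersection (top_of_set K) (top_of_set L) (\<lambda>x. x) (\<lambda>x. x) U V \<delta>"
    unfolding essential_intersection_def
  proof (intro allI impI, elim conjE)
    fix k1 k2 assume k1: "continuous_map (top_of_set K) euclidean k1" and k2: "continuous_map (top_of_set L) euclidean k2"
      and d1: "C0_dist (top_of_set K) (\<lambda>x. x) k1 \<le> ennreal \<delta>" and d2: "C0_dist (top_of_set L) (\<lambda>x. x) k2 \<le> ennreal \<delta>"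
    have k1c: "continuous_on K k1" and k2c: "continuous_on L k2" using k1 k2 by simp_all
    define F where "F t = ?u (k1 (?v (m t)))" for t
    define G where "G t = ?u (k2 (l t))" for t
    have F: "k1 (?v (m t)) \<in> dom_of c" "dist (m t) (F t) < \<eta>" if "t \<in> {0..1}" for t
    proof -
      have "dist (?v (m t)) (k1 (?v (m t))) \<le> \<delta>"
        using C0_dist_leD[OF d1] mK(1)[OF that] \<delta>(1) by simp
      from \<delta>(2)[OF mK(3)[OF that] this] show "k1 (?v (m t)) \<in> dom_of c" "dist (m t) (F t) < \<eta>"
        using v(1)[OF m[OF that]] by (simp_all add: F_def)
    qed
    have G: "k2 (l t) \<in> dom_of c" "dist (?u (l t)) (G t) < \<eta>" if "t \<in> {0..1}" for t
    proof -
      have "dist (l t) (k2 (l t)) \<le> \<delta>"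
        using C0_dist_leD[OF d2] lt(1)[OF that] \<delta>(1) by simp
      from \<delta>(2)[OF lt(4)[OF that] this] show "k2 (l t) \<in> dom_of c" "dist (?u (l t)) (G t) < \<eta>"
        by (simp_all add: G_def)
    qed
    have F_comp: "\<bar>F t $ i - m t $ i\<bar> < \<eta>" and G_comp: "\<bar>G t $ i - ?u (l t) $ i\<bar> < \<eta>"
      if "t \<in> {0..1}" for t i
      using F(2)[OF that] G(2)[OF that] component_le_norm_cart[of "F t - m t" i]
        component_le_norm_cart[of "G t - ?u (l t)" i]
      unfolding dist_norm norm_minus_commute[of "m t"] norm_minus_commute[of "?u (l t)"] by simp_all
    have l1: "\<bar>?u (l t) $ 1 - y0 $ 1\<bar> < R / 8" if "t \<in> {0..1}" for t
      using lt(3)[OF that] component_le_norm_cart[of "?u (l t) - y0" 1] by (simp add: dist_norm norm_minus_commute)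
    have "\<exists>s\<in>{0..1}. \<exists>t\<in>{0..1}. F s = G t"
    proof (rule crossing_paths_meet[where x="y0 $ 1" and \<rho>="R / 4" and \<eta>=\<eta>])
      have cvm: "continuous_on {0..1} (\<lambda>t. ?v (m t))"
        by (rule continuous_on_compose2[OF cv]) (use m in \<open>auto simp: m_def intro!: continuous_intros\<close>)
      have "continuous_on {0..1} (\<lambda>t. k1 (?v (m t)))"
        by (rule continuous_on_compose2[OF k1c cvm]) (use mK(1) in auto)
      then show "continuous_on {0..1} F" unfolding F_def[abs_def]
        by (rule continuous_on_compose2[OF continuous_on_coord[OF ch]]) (use F(1) in auto)
      have "continuous_on {0..1} (\<lambda>t. k2 (l t))"
        by (rule continuous_on_compose2[OF k2c l(1)[unfolded path_def]]) (use lt(1) in auto)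
      then show "continuous_on {0..1} G" unfolding G_def[abs_def]
        by (rule continuous_on_compose2[OF continuous_on_coord[OF ch]]) (use G(1) in auto)
      show "R / 4 > 0" "\<eta> > 0" using R(1) \<eta>(1) by auto
      show "F 0 $ 1 \<le> y0 $ 1 - R / 4" "F 1 $ 1 \<ge> y0 $ 1 + R / 4"
        using F_comp[of 0 1] F_comp[of 1 1] \<eta>(2) R(1) by (auto simp: m12)
      show "\<bar>F t $ 2\<bar> < \<eta>" if "t \<in> {0..1}" for t using F_comp[OF that, of 2] by (simp add: m12)
      have "l 0 = q2" "l 1 = q1" using l by (auto simp: pathstart_def pathfinish_def)
      then show "G 0 $ 2 \<le> - \<eta>" "G 1 $ 2 \<ge> \<eta>"
        using G_comp[of 0 2] G_comp[of 1 2] \<eta>(3,4) by auto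
      show "\<bar>G t $ 1 - y0 $ 1\<bar> < R / 4" if "t \<in> {0..1}" for t
        using G_comp[OF that, of 1] l1[OF that] \<eta>(2) by linarith
    qed
    then obtain s t where st: "s \<in> {0..1}" "t \<in> {0..1}" "F s = G t" by (elim bexE)
    have "?v (F s) = k1 (?v (m s))" unfolding F_def by (rule chart_inv_coord[OF ch F(1)[OF st(1)]])
    moreover have "?v (G t) = k2 (l t)" unfolding G_def by (rule chart_inv_coord[OF ch G(1)[OF st(2)]])
    ultimately have "k1 (?v (m s)) = k2 (l t)" using st(3) by metis
    have "?v (m s) \<in> U" "l t \<in> V" using mK[OF st(1)] lt[OF st(2)] U0 V0 by auto
    then show "k1 ` U \<inter> k2 ` V \<noteq> {}" using \<open>k1 (?v (m s)) = k2 (l t)\<close> by (metis IntI empty_iff imageI)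
  qed
  then show "\<exists>\<delta>>0. essential_intersection (top_of_set K) (top_of_set L) (\<lambda>x. x) (\<lambda>x. x) U V \<delta>"
    using \<delta>(1) by blast
qed

lemma C0_transverse_iff_crosses:
  fixes p :: "'a::metric_space"
  assumes c: "straightens c K" and p: "p \<in> K" "p \<in> L" "p \<in> dom_of c" and L: "C1_curve A L"
  shows "C0_transverse_subsets K L p \<longleftrightarrow> crosses (\<lambda>q. coord c q $ 2) L p"
proof
  show "crosses (\<lambda>q. coord c q $ 2) L p" if tr: "C0_transverse_subsets K L p"
  proof (rule ccontr)
    assume "\<not> ?thesis"
    then obtain W where W: "open W" "p \<in> W"
      and "\<not> ((\<exists>q\<in>L \<inter> W. coord c q $ 2 > 0) \<and> (\<exists>q\<in>L \<inter> W. coord c q $ 2 < 0))"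
      unfolding crosses_def by blast
    then have "(\<forall>q\<in>L \<inter> W. - 1 * coord c q $ 2 \<ge> 0) \<or> (\<forall>q\<in>L \<inter> W. 1 * coord c q $ 2 \<ge> 0)"
      by (auto simp: not_less)
    then show False
      using not_transverse_if_one_sided[OF c p W, of "-1"] not_transverse_if_one_sided[OF c p W, of 1] tr by auto
  qed
  show "C0_transverse_subsets K L p" if "crosses (\<lambda>q. coord c q $ 2) L p"
    by (rule transverse_if_crosses[OF c p L that])
qed

theorem mainTheorem3:
  fixes A :: "'a::metric_space chart set" and g :: "'a metric_tensor"
    and K L :: "'a set" and p :: 'a
  assumes "smooth_atlas A"
    and "riemannian_metric A g"
    and "riemannian_distance A g"
    and "C1_curve A K" and "C1_curve A L"
    and "p \<in> K \<inter> L"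
  shows "sakai_transverse K L p \<longleftrightarrow> C0_transverse_subsets K L p"
proof -
  have p: "p \<in> K" "p \<in> L" using assms(6) by auto
  obtain c where c: "straightens c K" "p \<in> dom_of c" using C1_curve_straightens[OF assms(4) p(1)] .
  have "sakai_transverse K L p \<longleftrightarrow> crosses (\<lambda>q. coord c q $ 2) L p"
    by (rule sakai_transverse_iff_crosses[OF small_ball_sides[OF assms(1-3) c(1) p(1) c(2)] assms(5) p(2,1)])
  also have "\<dots> \<longleftrightarrow> C0_transverse_subsets K L p"
    using C0_transverse_iff_crosses[OF c(1) p c(2) assms(5)] by simp
  finally show ?thesis .
qed

end
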